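(* Let $e\in C^{\alpha}$ on $(0,\pi)$, $\alpha>0$, be even with respect to $\frac{\pi}{2}$ with $\int_0^{\pi}e(x)\sin x\,dx=0$. Assume that $g\in C^2(\mathbb{R})$ satisfies $g'(u)<3$ for all $u\in\mathbb{R}$; $|g(u)|<\gamma|u|+c$ for all $u\in\mathbb{R}$, with some constants $0<\gamma<3$, $c\ge0$; and $\lim_{|u|\to\infty}\frac{g(uz)}{u}=0$ uniformly in $z\in\mathbb{R}$. Assume further that $g$ has finitely many roots on any bounded interval, and that it changes sign at each root. Let $H(u)=\int_0^u g(t)\,t\,dt$, and assume that there exist two sequences $\{\xi_n\}\to\infty$ and $\{\eta_n\}\to\infty$ such that $H(\xi_n)>\epsilon$ and $H(\eta_n)<-\epsilon$ for all $n$, for some $\epsilon>0$. Consider $$u''+u+g(u)=\mu_1\sin x+e(x)\ \text{ for }x\in(0,\pi),\qquad u(0)=u(\pi)=0,$$ with solution curve $\mu_1=\mu_1(\xi_1)$ (defined in the context). Then the function $\mu_1(\xi_1)$ changes sign infinitely many times as $\xi_1\to\infty$. In particular, at $\mu_1=0$ this problem has infinitely many solutions.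
   Context: Solutions are decomposed as $u(x)=\xi_1\sin x+U(x)$ with $\xi_1\in\mathbb{R}$ and $\int_0^{\pi}U(x)\sin x\,dx=0$. Under the stated assumptions it is known that for each $\xi_1\in\mathbb{R}$ there is a unique pair $(u,\mu_1)$ solving the problem with $u$ having first harmonic $\xi_1$, and that the solution set is a single continuous curve $(u(x),\mu_1)(\xi_1)$ parameterized by $\xi_1\in\mathbb{R}$; $\mu_1(\xi_1)$ denotes its second component. *)

theory Defs
  imports "HOL-Analysis.Analysis"
begin

text \<open>For open \<open>S\<close> the value of an iterated \<^const>\<open>deriv\<close> at a point of \<open>S\<close> depends only on \<open>f\<close> near
  that point, so \<open>f\<close> may be arbitrary outside \<open>S\<close>.\<close>

definition Ck_on :: "nat \<Rightarrow> (real \<Rightarrow> real) \<Rightarrow> real set \<Rightarrow> bool" where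
  "Ck_on k f S \<longleftrightarrow>
     (\<forall>j<k. \<forall>x\<in>S. (deriv ^^ j) f field_differentiable at x) \<and>
     (\<forall>j\<le>k. continuous_on S ((deriv ^^ j) f))"

text \<open>The Hoelder class \<open>C\<^sup>\<alpha>\<close> on an open set, for every \<open>\<alpha> > 0\<close>: write \<open>\<alpha> = k + \<beta>\<close> with
  \<open>0 < \<beta> \<le> 1\<close>; the derivatives up to order \<open>k\<close> exist and are bounded, and the \<open>k\<close>-th one is uniformly
  Hoelder continuous of exponent \<open>\<beta>\<close>. For integer \<open>\<alpha>\<close> this is the Lipschitz class \<open>C\<^sup>k\<^sup>,\<^sup>1\<close> with
  \<open>k = \<alpha> - 1\<close>.\<close>

definition holder_on :: "real \<Rightarrow> (real \<Rightarrow> real) \<Rightarrow> real set \<Rightarrow> bool" where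
  "holder_on \<alpha> f S \<longleftrightarrow>
     (\<exists>k \<beta> C. \<alpha> = real k + \<beta> \<and> 0 < \<beta> \<and> \<beta> \<le> 1 \<and> Ck_on k f S \<and>
        (\<forall>j\<le>k. bounded ((deriv ^^ j) f ` S)) \<and>
        (\<forall>x\<in>S. \<forall>y\<in>S. \<bar>(deriv ^^ k) f x - (deriv ^^ k) f y\<bar> \<le> C * \<bar>x - y\<bar> powr \<beta>))"

definition changes_sign_at :: "(real \<Rightarrow> real) \<Rightarrow> real \<Rightarrow> bool" where
  "changes_sign_at f r \<longleftrightarrow>
     (\<exists>\<delta>>0. \<forall>s\<in>{r - \<delta><..<r}. \<forall>t\<in>{r<..<r + \<delta>}. f s * f t < 0)"

definition changes_sign_infinitely_often_at_top :: "(real \<Rightarrow> real) \<Rightarrow> bool" where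
  "changes_sign_infinitely_often_at_top f \<longleftrightarrow>
     (\<exists>t :: nat \<Rightarrow> real. strict_mono t \<and> filterlim t at_top sequentially \<and>
        (\<forall>n. f (t n) * f (t (Suc n)) < 0))"

text \<open>Classical solutions of \<open>u'' + u + g(u) = \<mu> sin x + e(x)\<close> on \<open>(0, \<pi>)\<close>, \<open>u(0) = u(\<pi>) = 0\<close>.
  A solution is a function on \<open>[0, \<pi>]\<close>; membership in \<^const>\<open>extensional\<close> fixes its values elsewhere, so
  that uniqueness and the number of solutions have their usual meaning.\<close>

definition is_solution ::
    "(real \<Rightarrow> real) \<Rightarrow> (real \<Rightarrow> real) \<Rightarrow> real \<Rightarrow> (real \<Rightarrow> real) \<Rightarrow> bool" where
  "is_solution g e \<mu> u \<longleftrightarrow>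
     u \<in> extensional {0..pi} \<and> continuous_on {0..pi} u \<and> Ck_on 2 u {0<..<pi} \<and>
     (\<forall>x\<in>{0<..<pi}. deriv (deriv u) x + u x + g (u x) = \<mu> * sin x + e x) \<and>
     u 0 = 0 \<and> u pi = 0"

definition has_first_harmonic :: "(real \<Rightarrow> real) \<Rightarrow> real \<Rightarrow> bool" where
  "has_first_harmonic u \<xi> \<longleftrightarrow>
     (\<exists>U. (\<forall>x\<in>{0..pi}. u x = \<xi> * sin x + U x) \<and> ((\<lambda>x. U x * sin x) has_integral 0) {0..pi})"

text \<open>The solution curve \<open>\<xi> \<mapsto> (u, \<mu>)\<close>. Existence and uniqueness of the pair for every \<open>\<xi>\<close> is a
  consequence of the assumptions under which the curve is used; it is not assumed separately.\<close>

definition solution_curve ::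
    "(real \<Rightarrow> real) \<Rightarrow> (real \<Rightarrow> real) \<Rightarrow> real \<Rightarrow> (real \<Rightarrow> real) \<times> real" where
  "solution_curve g e \<xi> = (THE (u, \<mu>). is_solution g e \<mu> u \<and> has_first_harmonic u \<xi>)"

definition mu1 :: "(real \<Rightarrow> real) \<Rightarrow> (real \<Rightarrow> real) \<Rightarrow> real \<Rightarrow> real" where
  "mu1 g e \<xi> = snd (solution_curve g e \<xi>)"

end

theory Submission
  imports Defs
begin

text \<open>
  Testing the sublinear-growth condition at arbitrary \<open>z\<close> shows that \<open>g\<close> is bounded. For uniqueness,
  the difference \<open>w\<close> of two solutions with the same first harmonic is orthogonal to \<open>sin\<close>, so
  \<open>\<integral>w'\<^sup>2 \<ge> 4\<integral>w\<^sup>2\<close>, while \<open>g' < 3\<close> gives the strict reverse inequality unless \<open>w = 0\<close>.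

  Even solutions are found by shooting from the midpoint: for \<open>u(\<pi>/2) = M\<close>, \<open>u'(\<pi>/2) = 0\<close> the endpoint
  value at \<open>\<pi>\<close> is continuous in \<open>M\<close> and \<open>\<mu>\<close>, is positive for large \<open>\<mu>\<close> and negative for large \<open>-\<mu>\<close>,
  and its zeros satisfy \<open>\<mu> \<pi>/4 = \<integral> g(u) sin\<close> over a half interval. Along a solution,
  \<open>g(u) sin x dx = (sin x / (u u')) dH(u)\<close>, and \<open>sin x / (u u')\<close> is approximately \<open>1 / (M sqrt (M\<^sup>2 - u\<^sup>2))\<close>,
  increasing in \<open>u\<close>. Hence the integral has the sign of \<open>H(M)\<close> whenever \<open>\<bar>H\<bar>\<close> is almost maximal at \<open>M\<close>
  among the points below \<open>M\<close>, and such \<open>M\<close> of both signs exist arbitrarily far out. So every zero \<open>\<mu>\<close>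
  is positive at some large \<open>M\<close> and negative at others; at \<open>\<mu> = 0\<close> the endpoint value then changes
  sign infinitely often in \<open>M\<close>, and the intermediate value theorem gives infinitely many solutions.
\<close>

section \<open>Uniqueness for a given first harmonic\<close>

lemma abs_diff_le_of_abs_deriv_le:
  fixes F G F' G' :: "real \<Rightarrow> real"
  assumes "a \<le> b"
    and "\<And>x. x \<in> {a..b} \<Longrightarrow> (F has_real_derivative F' x) (at x)"
    and "\<And>x. x \<in> {a..b} \<Longrightarrow> (G has_real_derivative G' x) (at x)"
    and "\<And>x. x \<in> {a..b} \<Longrightarrow> \<bar>F' x\<bar> \<le> G' x"
  shows "\<bar>F b - F a\<bar> \<le> G b - G a"
proof -
  have "G a - F a \<le> G b - F b"
  proof (rule DERIV_nonneg_imp_nondecreasing[OF assms(1), of "\<lambda>x. G x - F x"])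
    fix x assume "a \<le> x" "x \<le> b"
    then have x: "x \<in> {a..b}" by simp
    show "\<exists>d. ((\<lambda>x. G x - F x) has_real_derivative d) (at x) \<and> 0 \<le> d"
      using DERIV_diff[OF assms(3)[OF x] assms(2)[OF x]] assms(4)[OF x] by (intro exI[of _ "G' x - F' x"]) auto
  qed
  moreover have "G a + F a \<le> G b + F b"
  proof (rule DERIV_nonneg_imp_nondecreasing[OF assms(1), of "\<lambda>x. G x + F x"])
    fix x assume "a \<le> x" "x \<le> b"
    then have x: "x \<in> {a..b}" by simp
    show "\<exists>d. ((\<lambda>x. G x + F x) has_real_derivative d) (at x) \<and> 0 \<le> d"
      using DERIV_add[OF assms(3)[OF x] assms(2)[OF x]] assms(4)[OF x] by (intro exI[of _ "G' x + F' x"]) auto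
  qed
  ultimately show ?thesis by linarith
qed

lemma sin_ge_half_min:
  assumes "x \<in> {0<..<pi}"
  shows "min x (pi - x) / 2 \<le> sin x"
proof -
  have *: "y / 2 \<le> sin y" if "0 \<le> y" "y \<le> pi / 2" for y :: real
  proof (cases "y \<le> pi / 3")
    case True
    have "(\<lambda>y. sin y - y / 2) 0 \<le> (\<lambda>y. sin y - y / 2) y"
    proof (rule DERIV_nonneg_imp_nondecreasing[OF that(1)])
      fix t assume "0 \<le> t" "t \<le> y"
      then have "cos (pi / 3) \<le> cos t"
        using True pi_gt_zero by (intro cos_monotone_0_pi_le) auto
      then show "\<exists>d. ((\<lambda>y. sin y - y / 2) has_real_derivative d) (at t) \<and> 0 \<le> d"
        by (intro exI[of _ "cos t - 1/2"]) (auto intro!: derivative_eq_intros simp: cos_60)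
    qed
    then show ?thesis by simp
  next
    case False
    then have "sin (pi / 3) \<le> sin y"
      using that by (intro sin_monotone_2pi_le) auto
    \<comment> \<open>The rational 8/5 separates pi/2 from sqrt 3, so sin y \<ge> sqrt 3 / 2 > 4/5 >
      pi/4 \<ge> y/2.\<close>
    moreover have "(8/5)\<^sup>2 \<le> (3::real)" by (simp add: power2_eq_square)
    then have "8 / 5 \<le> sqrt 3" by (metis real_le_rsqrt)
    moreover have "pi / 2 < 8 / 5" using pi_less_4 pi_approx by simp
    ultimately show ?thesis using that by (simp add: sin_60)
  qed
  show ?thesis
  proof (cases "x \<le> pi / 2")
    case True
    then show ?thesis using *[of x] assms by (auto simp: min_def)
  next
    case False
    then show ?thesis using *[of "pi - x"] assms by (auto simp: min_def)
  qed
qed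

text \<open>Derivatives are available only in the open interval, so the zero boundary values of w
  and its orthogonality to sin enter as decay rates: \<open>p\<close> is the primitive of w sin that
  vanishes at both ends. These rates force a nondecreasing function \<open>Q\<close> to tend to 0 at
  both ends; so \<open>Q\<close> vanishes identically, whereas its derivative is positive wherever w
  is nonzero.\<close>

lemma orthogonal_rigidity:
  fixes w w1 w2 p :: "real \<Rightarrow> real"
  assumes w: "\<And>x. x \<in> {0<..<pi} \<Longrightarrow> (w has_real_derivative w1 x) (at x)"
    and w1: "\<And>x. x \<in> {0<..<pi} \<Longrightarrow> (w1 has_real_derivative w2 x) (at x)"
    and p: "\<And>x. x \<in> {0<..<pi} \<Longrightarrow> (p has_real_derivative w x * sin x) (at x)"
    and wb: "\<And>x. x \<in> {0<..<pi} \<Longrightarrow> \<bar>w x\<bar> \<le> C * min x (pi - x)"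
    and w1b: "\<And>x. x \<in> {0<..<pi} \<Longrightarrow> \<bar>w1 x\<bar> \<le> C"
    and pb: "\<And>x. x \<in> {0<..<pi} \<Longrightarrow> \<bar>p x\<bar> \<le> C * (min x (pi - x))\<^sup>2"
    and pos: "\<And>x. x \<in> {0<..<pi} \<Longrightarrow> w x \<noteq> 0 \<Longrightarrow>
      0 < w x * w2 x + 4 * (w x)\<^sup>2 - \<nu> * (w x * sin x)"
    and x: "x \<in> {0<..<pi}"
  shows "w x = 0"
proof (rule ccontr)
  assume wx: "w x \<noteq> 0"
  \<comment> \<open>The derivative of \<open>Q\<close> is the expression in \<open>pos\<close> plus two squares: this is the inequality
    \<open>\<integral>w'\<^sup>2 \<ge> 4\<integral>w\<^sup>2\<close> for \<open>w \<perp> sin\<close>, found by factoring \<open>-d\<^sup>2/dx\<^sup>2 - 1 = A\<^sup>*A\<close> with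
    \<open>A = d/dx - cot x\<close>, whose companion \<open>AA\<^sup>*\<close> has the ground state \<open>sin\<^sup>2\<close> with eigenvalue \<open>3\<close>.\<close>
  define y where "y x = p x / sin x" for x
  define Q where "Q x = w x * w1 x - cos x / sin x * ((w x)\<^sup>2 + 9 * (y x)\<^sup>2)
    + 6 * w x * y x - \<nu> * p x" for x
  define Q' where "Q' x = (w1 x - cos x / sin x * w x + 3 * y x)\<^sup>2
    + 3 * (w x - 3 * (cos x / sin x) * y x)\<^sup>2
    + (w x * w2 x + 4 * (w x)\<^sup>2 - \<nu> * (w x * sin x))" for x
  have s: "sin x > 0" if "x \<in> {0<..<pi}" for x using that by (auto intro: sin_gt_zero)
  have Q: "(Q has_real_derivative Q' x) (at x)" if x: "x \<in> {0<..<pi}" for x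
  proof -
    define ct where "ct = (\<lambda>x::real. cos x / sin x)"
    have dct: "(ct has_real_derivative - 1 - (ct x)\<^sup>2) (at x)"
      unfolding ct_def using s[OF x]
      by (auto intro!: derivative_eq_intros simp: field_simps power2_eq_square)
    \<comment> \<open>With \<open>A = d/dx - cot x\<close> this reads
      \<open>- A\<^sup>* y = w\<close>, so \<open>y\<close> inverts the adjoint; the decay of
      \<open>p\<close> keeps \<open>y\<close> regular at the ends.\<close>
    have dy: "(y has_real_derivative w x - ct x * y x) (at x)"
      unfolding y_def ct_def using s[OF x]
      by (auto intro!: derivative_eq_intros p x simp: field_simps power2_eq_square)
    have "Q = (\<lambda>x. w x * w1 x - ct x * ((w x)\<^sup>2 + 9 * (y x)\<^sup>2) + 6 * w x * y x - \<nu> * p x)"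
      by (simp add: Q_def ct_def fun_eq_iff)
    moreover have "((\<lambda>x. w x * w1 x - ct x * ((w x)\<^sup>2 + 9 * (y x)\<^sup>2) + 6 * w x * y x - \<nu> * p x)
      has_real_derivative Q' x) (at x)"
      unfolding Q'_def ct_def[symmetric]
      by (rule derivative_eq_intros dct dy w w1 p x refl)+
        (simp add: ct_def[symmetric, THEN fun_cong, simplified] algebra_simps power2_eq_square)
    ultimately show ?thesis by simp
  qed
  have Q'0: "0 \<le> Q' x" if "x \<in> {0<..<pi}" for x
    using pos[OF that] by (cases "w x = 0") (auto simp: Q'_def intro!: add_nonneg_nonneg)
  have Q'p: "0 < Q' x"
    using pos[OF x wx] by (auto simp: Q'_def intro!: add_nonneg_pos)
  have mono: "Q a \<le> Q b" if "0 < a" "a \<le> b" "b < pi" for a b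
    by (rule DERIV_nonneg_imp_nondecreasing[OF that(2)])
      (use that Q Q'0 in \<open>force intro!: exI[of _ "Q' _"]\<close>)
  \<comment> \<open>One summand for each term of \<open>Q\<close>. The distance m to the nearer end
    is at most pi/2 < 2, which absorbs surplus powers of m; the factor 2/m from the cotangent meets
    squares of order m^2.\<close>
  define K where "K = C*C + 2 * (C\<^sup>2 + 36 * C\<^sup>2) + 24 * C\<^sup>2 + 2 * \<bar>\<nu>\<bar> * C"
  have Qb: "\<bar>Q x\<bar> \<le> K * min x (pi - x)" if x: "x \<in> {0<..<pi}" for x
  proof -
    define m where "m = min x (pi - x)"
    have m: "0 < m" "m / 2 \<le> sin x" "m \<le> 2"
      using x sin_ge_half_min[OF x] pi_less_4 by (auto simp: m_def)
    have C: "0 \<le> C" using w1b[OF x] by simp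
    have yb: "\<bar>y x\<bar> \<le> 2 * C * m"
    proof -
      have "\<bar>p x\<bar> \<le> C * m\<^sup>2" using pb[OF x] by (simp add: m_def)
      also have "\<dots> \<le> 2 * C * m * sin x"
        using mult_left_mono[OF m(2), of "2 * C * m"] C m by (simp add: power2_eq_square)
      finally show ?thesis using s[OF x] by (simp add: y_def field_simps)
    qed
    have wb': "\<bar>w x\<bar> \<le> C * m" using wb[OF x] by (simp add: m_def)
    have ctb: "\<bar>cos x / sin x\<bar> \<le> 2 / m"
    proof -
      have "\<bar>cos x / sin x\<bar> \<le> 1 / sin x" using s[OF x] by (simp add: divide_right_mono)
      also have "\<dots> \<le> 1 / (m / 2)" using m by (intro divide_left_mono) auto
      finally show ?thesis by simp
    qed
    have "\<bar>w x * w1 x\<bar> \<le> (C * m) * C"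
      unfolding abs_mult using wb' w1b[OF x] C m by (intro mult_mono) auto
    moreover have "\<bar>cos x / sin x * ((w x)\<^sup>2 + 9 * (y x)\<^sup>2)\<bar> \<le> 2 / m * ((C*m)\<^sup>2 + 9 * (2*C*m)\<^sup>2)"
    proof -
      have "(w x)\<^sup>2 \<le> (C*m)\<^sup>2" "(y x)\<^sup>2 \<le> (2*C*m)\<^sup>2"
        using wb' yb by (metis abs_ge_zero power2_abs power_mono)+
      then show ?thesis unfolding abs_mult using ctb m
        by (intro mult_mono) auto
    qed
    moreover have "2 / m * ((C*m)\<^sup>2 + 9 * (2*C*m)\<^sup>2) = 2 * (C\<^sup>2 + 36 * C\<^sup>2) * m"
      using m by (simp add: field_simps power2_eq_square)
    moreover have "\<bar>6 * w x * y x\<bar> \<le> 24 * C\<^sup>2 * m"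
    proof -
      have "\<bar>w x\<bar> * \<bar>y x\<bar> \<le> (C * 2) * (2*C*m)"
        using wb' yb C m by (intro mult_mono) (auto intro: order_trans[OF _ mult_left_mono])
      then show ?thesis by (simp add: abs_mult power2_eq_square)
    qed
    moreover have "\<bar>\<nu> * p x\<bar> \<le> 2 * \<bar>\<nu>\<bar> * C * m"
    proof -
      have "\<bar>p x\<bar> \<le> C * m\<^sup>2" using pb[OF x] by (simp add: m_def)
      also have "\<dots> \<le> C * (2 * m)" using C m by (intro mult_left_mono) (auto simp: power2_eq_square)
      finally show ?thesis
        using mult_left_mono[of "\<bar>p x\<bar>" "C * (2 * m)" "\<bar>\<nu>\<bar>"] by (simp add: abs_mult algebra_simps)
    qed
    ultimately show ?thesis
      unfolding Q_def K_def m_def[symmetric] by (simp add: algebra_simps)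
  qed
  have K0: "0 \<le> K" proof -
    have "0 \<le> K * min x (pi - x)" using order_trans[OF abs_ge_zero Qb[OF x]] .
    moreover have "0 < min x (pi - x)" using x by auto
    ultimately show ?thesis by (simp only: zero_le_mult_iff) linarith
  qed
  \<comment> \<open>Monotonicity carries the bounds -K t near 0 and K (pi - t) near pi to the fixed
    point x; letting t tend to the respective end gives both inequalities.\<close>
  have Qz: "Q x = 0" if x: "x \<in> {0<..<pi}" for x
  proof (rule antisym)
    show "0 \<le> Q x"
    proof (rule tendsto_upperbound)
      show "((\<lambda>y. - (K * y)) \<longlongrightarrow> 0) (at_right 0)" by (auto intro!: tendsto_eq_intros)
      show "\<forall>\<^sub>F y in at_right 0. - (K * y) \<le> Q x"
        unfolding eventually_at_right_field
      proof (intro exI[of _ x] conjI allI impI)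
        fix t assume t: "0 < t" "t < x"
        have "\<bar>Q t\<bar> \<le> K * min t (pi - t)" using Qb[of t] t x by auto
        also have "\<dots> \<le> K * t" by (rule mult_left_mono[OF _ K0]) simp
        finally show "- (K * t) \<le> Q x" using mono[of t x] t x by auto
      qed (use x in auto)
    qed simp
    show "Q x \<le> 0"
    proof (rule tendsto_lowerbound)
      show "((\<lambda>y. K * (pi - y)) \<longlongrightarrow> 0) (at_left pi)" by (auto intro!: tendsto_eq_intros)
      show "\<forall>\<^sub>F y in at_left pi. Q x \<le> K * (pi - y)"
        unfolding eventually_at_left_field
      proof (intro exI[of _ x] conjI allI impI)
        fix t assume t: "t < pi" "x < t"
        have "\<bar>Q t\<bar> \<le> K * min t (pi - t)" using Qb[of t] t x by auto
        also have "\<dots> \<le> K * (pi - t)" by (rule mult_left_mono[OF _ K0]) simp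
        finally show "Q x \<le> K * (pi - t)" using mono[of x t] t x by auto
      qed (use x in auto)
    qed simp
  qed
  have "(Q has_real_derivative 0) (at x)"
  proof (rule has_field_derivative_transform_within_open[of "\<lambda>_. 0"])
    show "open {0<..<pi}" by simp
  qed (use x Qz in auto)
  then show False using DERIV_unique[OF Q[OF x]] Q'p by auto
qed

section \<open>First harmonics as integrals, and uniqueness of the solution pair\<close>

lemma has_integral_sin_squared: "((\<lambda>x::real. (sin x)\<^sup>2) has_integral pi / 2) {0..pi}"
proof -
  have "((\<lambda>x::real. (sin x)\<^sup>2) has_integral
      ((\<lambda>x. (x - sin x * cos x) / 2) pi - (\<lambda>x. (x - sin x * cos x) / 2) 0)) {0..pi}"
  proof (rule fundamental_theorem_of_calculus)
    fix x :: real
    have "((\<lambda>x. (x - sin x * cos x) / 2) has_real_derivative (sin x)\<^sup>2) (at x within {0..pi})"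
      using sin_squared_eq[of x] by (auto intro!: derivative_eq_intros simp: power2_eq_square)
    then show "((\<lambda>x. (x - sin x * cos x) / 2) has_vector_derivative (sin x)\<^sup>2)
        (at x within {0..pi})"
      by (simp add: has_real_derivative_iff_has_vector_derivative)
  qed simp
  then show ?thesis by simp
qed

text \<open>Pairing with sin removes U and leaves \<xi> times the integral of sin^2, which is
  pi/2.\<close>

lemma has_first_harmonicD:
  assumes "has_first_harmonic u \<xi>"
  shows "((\<lambda>x. u x * sin x) has_integral \<xi> * (pi / 2)) {0..pi}"
proof -
  obtain U where U: "\<And>x. x \<in> {0..pi} \<Longrightarrow> u x = \<xi> * sin x + U x"
    "((\<lambda>x. U x * sin x) has_integral 0) {0..pi}"
    using assms by (auto simp: has_first_harmonic_def)
  have "((\<lambda>x. \<xi> * (sin x)\<^sup>2 + U x * sin x) has_integral \<xi> * (pi / 2) + 0) {0..pi}"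
    by (intro has_integral_add has_integral_mult_right has_integral_sin_squared U)
  then have "((\<lambda>x. \<xi> * (sin x)\<^sup>2 + U x * sin x) has_integral \<xi> * (pi / 2)) {0..pi}" by simp
  then show ?thesis
    by (rule has_integral_eq[rotated]) (simp add: U algebra_simps power2_eq_square)
qed

lemma has_first_harmonicI:
  assumes "((\<lambda>x. u x * sin x) has_integral \<xi> * (pi / 2)) {0..pi}"
  shows "has_first_harmonic u \<xi>"
  unfolding has_first_harmonic_def
proof (intro exI[of _ "\<lambda>x. u x - \<xi> * sin x"] conjI ballI)
  have "((\<lambda>x. u x * sin x - \<xi> * (sin x)\<^sup>2) has_integral \<xi> * (pi / 2) - \<xi> * (pi / 2)) {0..pi}"
    by (intro has_integral_diff has_integral_mult_right has_integral_sin_squared assms)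
  then show "((\<lambda>x. (u x - \<xi> * sin x) * sin x) has_integral 0) {0..pi}"
    by (simp add: algebra_simps power2_eq_square)
qed simp

lemma is_solution_derivs:
  assumes "is_solution g e \<mu> u" and x: "x \<in> {0<..<pi}"
  shows "(u has_real_derivative deriv u x) (at x)"
    and "(deriv u has_real_derivative \<mu> * sin x + e x - u x - g (u x)) (at x)"
proof -
  have C: "Ck_on 2 u {0<..<pi}"
    and ode: "deriv (deriv u) x + u x + g (u x) = \<mu> * sin x + e x"
    using assms by (auto simp: is_solution_def)
  have "(deriv ^^ 0) u field_differentiable at x" "(deriv ^^ 1) u field_differentiable at x"
    using C x unfolding Ck_on_def by (metis pos2, metis one_less_numeral_iff semiring_norm(76))
  then have "u field_differentiable at x" "deriv u field_differentiable at x" by simp_all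
  then have "(u has_real_derivative deriv u x) (at x)"
    "(deriv u has_real_derivative deriv (deriv u) x) (at x)"
    by (simp_all add: field_differentiable_derivI)
  moreover have "deriv (deriv u) x = \<mu> * sin x + e x - u x - g (u x)" using ode by simp
  ultimately show "(u has_real_derivative deriv u x) (at x)"
    "(deriv u has_real_derivative \<mu> * sin x + e x - u x - g (u x)) (at x)" by simp_all
qed

text \<open>The forcing e cancels in the difference w of the two solutions and g is bounded, so w''
  is bounded. Hence w' is bounded, and w and the primitive of w sin decay at the ends as
  \<open>orthogonal_rigidity\<close> asks. The difference of the two multipliers takes the place of
  its parameter \<open>\<nu>\<close>.\<close>

lemma solution_unique:
  assumes g: "\<And>t. (g has_real_derivative g' t) (at t)" and g3: "\<And>t. g' t < 3"
    and gG: "\<And>t. \<bar>g t\<bar> \<le> G"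
    and u: "is_solution g e \<mu> u" "has_first_harmonic u \<xi>"
    and v: "is_solution g e \<nu> v" "has_first_harmonic v \<xi>"
  shows "u = v \<and> \<mu> = \<nu>"
proof -
  define w where "w x = u x - v x" for x
  define w1 where "w1 x = deriv u x - deriv v x" for x
  define w2 where "w2 x = (\<mu> - \<nu>) * sin x - w x - (g (u x) - g (v x))" for x
  define p where "p x = integral {0..x} (\<lambda>x. w x * sin x)" for x
  have w: "(w has_real_derivative w1 x) (at x)" if "x \<in> {0<..<pi}" for x
    unfolding w_def w1_def
    by (intro derivative_intros is_solution_derivs[OF u(1) that] is_solution_derivs[OF v(1) that])
  have w1: "(w1 has_real_derivative w2 x) (at x)" if "x \<in> {0<..<pi}" for x
    unfolding w1_def w2_def
    using DERIV_diff[OF is_solution_derivs(2)[OF u(1) that] is_solution_derivs(2)[OF v(1) that]]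
    by (simp add: algebra_simps w_def)
  have w0: "w 0 = 0" "w pi = 0" using u(1) v(1) by (auto simp: w_def is_solution_def)
  have wc: "continuous_on {0..pi} w"
    unfolding w_def using u(1) v(1) by (auto simp: is_solution_def intro!: continuous_intros)
  obtain W where W: "\<And>x. x \<in> {0..pi} \<Longrightarrow> \<bar>w x\<bar> \<le> W"
    using compact_imp_bounded[OF compact_continuous_image[OF wc compact_Icc]]
    unfolding bounded_iff by (metis imageI real_norm_def)
  define A where "A = \<bar>\<mu> - \<nu>\<bar> + W + 2 * G"
  have w2A: "\<bar>w2 x\<bar> \<le> A" if "x \<in> {0<..<pi}" for x
  proof -
    have "\<bar>(\<mu> - \<nu>) * sin x\<bar> \<le> \<bar>\<mu> - \<nu>\<bar> * 1" unfolding abs_mult by (intro mult_left_mono) auto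
    then show ?thesis using W[of x] gG[of "u x"] gG[of "v x"] that
      unfolding w2_def A_def by auto
  qed
  have A0: "0 \<le> A" using w2A[of "pi/2"] by (simp add: order_trans[OF abs_ge_zero])
  \<comment> \<open>Integrating w'' from the midpoint costs at most A times the distance, which is
    below 4.\<close>
  define C where "C = \<bar>w1 (pi/2)\<bar> + A * 4"
  \<comment> \<open>A mean value bound for functions differentiable only in the interior, since w
    and p are known to be merely continuous at 0 and pi.\<close>
  have lin: "\<bar>F b - F a\<bar> \<le> K * (b - a)"
    if ab: "0 \<le> a" "a \<le> b" "b \<le> pi" "continuous_on {a..b} F"
      "\<And>x. a < x \<Longrightarrow> x < b \<Longrightarrow> (F has_real_derivative F' x) (at x)"
      "\<And>x. a < x \<Longrightarrow> x < b \<Longrightarrow> \<bar>F' x\<bar> \<le> K" for a b F F' and K :: real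
  proof (cases "a = b")
    case False
    then have "a < b" using ab(2) by simp
    then obtain l z where z: "a < z" "z < b" "(F has_real_derivative l) (at z)"
        "F b - F a = (b - a) * l"
      using MVT[OF _ ab(4)] ab(5) real_differentiable_def by metis
    have "l = F' z" by (rule DERIV_unique[OF z(3) ab(5)[OF z(1,2)]])
    then have "\<bar>l\<bar> \<le> K" using ab(6)[OF z(1,2)] by simp
    then have "(b - a) * \<bar>l\<bar> \<le> (b - a) * K" using ab(2) by (intro mult_left_mono) auto
    then show ?thesis using z(4) ab(2) by (simp add: abs_mult mult.commute)
  qed simp
  have w1C: "\<bar>w1 x\<bar> \<le> C" if x: "x \<in> {0<..<pi}" for x
  proof -
    have "\<bar>w1 (max x (pi/2)) - w1 (min x (pi/2))\<bar> \<le> A * (max x (pi/2) - min x (pi/2))"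
    proof (rule lin[where F' = w2])
      show "continuous_on {min x (pi/2)..max x (pi/2)} w1"
        using x pi_gt_zero
        by (intro DERIV_continuous_on[of _ _ w2] has_field_derivative_at_within[OF w1]) (auto simp: min_def max_def split: if_splits)
    qed (use x pi_gt_zero w1 w2A in \<open>auto simp: min_def max_def split: if_splits\<close>)
    also have "\<dots> \<le> A * 4" using x pi_less_4 A0 by (intro mult_left_mono) auto
    finally show ?thesis unfolding C_def by (auto simp: min_def max_def split: if_splits)
  qed
  have wl: "\<bar>w x\<bar> \<le> C * min x (pi - x)" if x: "x \<in> {0<..<pi}" for x
  proof -
    have "\<bar>w x - w 0\<bar> \<le> C * (x - 0)"
      by (rule lin[where F' = w1])
        (use x w w1C in \<open>auto intro: continuous_on_subset[OF wc]\<close>)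
    moreover have "\<bar>w pi - w x\<bar> \<le> C * (pi - x)"
      by (rule lin[where F' = w1])
        (use x w w1C in \<open>auto intro: continuous_on_subset[OF wc]\<close>)
    ultimately show ?thesis using w0 by (simp add: min_def)
  qed
  have wsc: "continuous_on {0..pi} (\<lambda>x. w x * sin x)" by (intro continuous_intros wc)
  have p: "(p has_real_derivative w x * sin x) (at x)" if "x \<in> {0<..<pi}" for x
    using integral_has_real_derivative[OF wsc, of x] that at_within_Icc_at[of 0 x pi]
    unfolding p_def by auto
  have pc: "continuous_on {0..pi} p"
    unfolding p_def using wsc by (intro indefinite_integral_continuous_1 integrable_continuous_real)
  have "((\<lambda>x. u x * sin x - v x * sin x) has_integral \<xi> * (pi / 2) - \<xi> * (pi / 2)) {0..pi}"
    by (intro has_integral_diff has_first_harmonicD u v)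
  then have p0: "p 0 = 0" "p pi = 0"
    by (auto simp: p_def w_def algebra_simps integral_unique)
  have C0: "0 \<le> C" using A0 by (simp add: C_def)
  have pl: "\<bar>p x\<bar> \<le> C * (min x (pi - x))\<^sup>2" if x: "x \<in> {0<..<pi}" for x
  proof -
    have b: "\<bar>w t * sin t\<bar> \<le> C * min t (pi - t)" if "t \<in> {0<..<pi}" for t
    proof -
      have "\<bar>w t * sin t\<bar> \<le> \<bar>w t\<bar> * 1" unfolding abs_mult by (intro mult_left_mono) auto
      then show ?thesis using wl[OF that] by linarith
    qed
    have "\<bar>p x - p 0\<bar> \<le> (C * x) * (x - 0)"
    proof (rule lin[where F' = "\<lambda>x. w x * sin x"])
      fix t assume t: "0 < t" "t < x"
      have "C * min t (pi - t) \<le> C * x" using t C0 by (intro mult_left_mono) auto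
      then show "\<bar>w t * sin t\<bar> \<le> C * x" using b[of t] t x by auto
    qed (use x p in \<open>auto intro: continuous_on_subset[OF pc]\<close>)
    moreover have "\<bar>p pi - p x\<bar> \<le> (C * (pi - x)) * (pi - x)"
    proof (rule lin[where F' = "\<lambda>x. w x * sin x"])
      fix t assume t: "x < t" "t < pi"
      have "C * min t (pi - t) \<le> C * (pi - x)" using t C0 by (intro mult_left_mono) auto
      then show "\<bar>w t * sin t\<bar> \<le> C * (pi - x)" using b[of t] t x by auto
    qed (use x p in \<open>auto intro: continuous_on_subset[OF pc]\<close>)
    ultimately show ?thesis using p0 by (simp add: min_def power2_eq_square)
  qed
  \<comment> \<open>Inserting w'' turns the expression into 3 w^2 - (g(u) - g(v)) w, which is
    positive by the mean value theorem and g' < 3.\<close>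
  have pos: "0 < w x * w2 x + 4 * (w x)\<^sup>2 - (\<mu> - \<nu>) * (w x * sin x)" if wx: "w x \<noteq> 0" for x
  proof -
    have "(g (u x) - g (v x)) * (u x - v x) < 3 * (u x - v x)\<^sup>2"
    proof -
      have *: "(g b - g a) * (b - a) < 3 * (b - a)\<^sup>2" if ab: "a < b" for a b
      proof -
        obtain z where "g b - g a = (b - a) * g' z" using MVT2[OF ab, of g g'] g by blast
        then have "(g b - g a) * (b - a) = g' z * (b - a)\<^sup>2" by (simp add: power2_eq_square)
        also have "\<dots> < 3 * (b - a)\<^sup>2" using ab g3 by (intro mult_strict_right_mono) auto
        finally show ?thesis .
      qed
      consider "u x < v x" | "v x < u x" using wx by (fastforce simp: w_def)
      then show ?thesis
      proof cases
        case 1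
        then show ?thesis using *[OF 1] by (simp add: algebra_simps power2_eq_square)
      qed (rule *)
    qed
    then show ?thesis by (simp add: w2_def w_def algebra_simps power2_eq_square)
  qed
  have wz: "w x = 0" if "x \<in> {0<..<pi}" for x
    by (rule orthogonal_rigidity[OF w w1 p wl w1C pl pos that])
  have "u = v"
  proof (rule extensionalityI[of _ "{0..pi}"])
    show "u x = v x" if "x \<in> {0..pi}" for x
      using wz[of x] w0 that unfolding w_def
      by (cases "x = 0 \<or> x = pi") (auto simp: less_le)
  qed (use u v in \<open>auto simp: is_solution_def\<close>)
  \<comment> \<open>Once u = v, the two equations at pi/2, where sin is 1, differ only in the
    multiplier.\<close>
  moreover have "\<mu> = \<nu>"
  proof -
    have "pi / 2 \<in> {0<..<pi}" by simp
    from DERIV_unique[OF is_solution_derivs(2)[OF u(1) this]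
        is_solution_derivs(2)[OF v(1)[folded \<open>u = v\<close>] this]]
    show ?thesis by simp
  qed
  ultimately show ?thesis by simp
qed

text \<open>Uniqueness makes the description of the curve definite as soon as one pair is exhibited,
  so \<open>mu1\<close> can be read off from any solution found by shooting.\<close>

lemma mu1_eq:
  assumes "\<And>t. (g has_real_derivative g' t) (at t)" and "\<And>t. g' t < 3"
    and "\<And>t. \<bar>g t\<bar> \<le> G"
    and "is_solution g e \<mu> u" "has_first_harmonic u \<xi>"
  shows "mu1 g e \<xi> = \<mu>"
proof -
  have "solution_curve g e \<xi> = (u, \<mu>)"
    unfolding solution_curve_def
  proof (rule the_equality)
    fix z assume z: "case z of (u, \<mu>) \<Rightarrow> is_solution g e \<mu> u \<and> has_first_harmonic u \<xi>"
    obtain v \<nu> where "z = (v, \<nu>)" by fastforce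
    with z show "z = (u, \<mu>)" using solution_unique[OF assms(1-3) _ _ assms(4,5)] by auto
  qed (use assms in simp)
  then show ?thesis by (simp add: mu1_def)
qed

section \<open>The sign of the projected nonlinearity\<close>

text \<open>At such M the function H is almost at its running maximum, up to a slack linear in M -
  v. If H is unbounded above on the half line, M is a maximum point over a long interval. Otherwise
  compare with L = limsup H \<ge> \<epsilon>: maximum points of H itself could stay bounded, and the
  slack is the price of forcing them outward.\<close>

lemma good_amplitude:
  fixes H :: "real \<Rightarrow> real" and \<xi> :: "nat \<Rightarrow> real"
  assumes Hc: "continuous_on UNIV H" and \<xi>: "filterlim \<xi> at_top sequentially"
    and \<epsilon>: "0 < \<epsilon>" and H\<xi>: "\<And>n. H (\<xi> n) > \<epsilon>"
  shows "\<exists>r\<ge>r0. \<forall>N. \<exists>M\<ge>N. \<epsilon> / 2 \<le> H M \<and>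
    (\<forall>v\<in>{r..M}. H v \<le> H M + H M / 100 * ((M - v) / M))"
proof (cases "\<exists>K. \<forall>v\<ge>0. H v \<le> K")
  case False
  show ?thesis
  proof (rule exI[of _ "max r0 0"], intro conjI allI)
    fix N :: real
    define N' where "N' = max N 1"
    obtain a where a: "\<And>v. v \<in> {0..N'} \<Longrightarrow> H v \<le> H a"
      using continuous_attains_sup[OF compact_Icc _ continuous_on_subset[OF Hc subset_UNIV], of 0 N']
      by (fastforce simp: N'_def)
    define K where "K = H a"
    have K: "\<And>v. v \<in> {0..N'} \<Longrightarrow> H v \<le> K" using a by (simp add: K_def)
    obtain q where q: "0 \<le> q" "H q > max K \<epsilon>" using False by (metis not_le)
    obtain M where M: "M \<in> {0..q}" "\<And>v. v \<in> {0..q} \<Longrightarrow> H v \<le> H M"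
      using continuous_attains_sup[of "{0..q}" H] q continuous_on_subset[OF Hc] by auto
    have HM: "H M > max K \<epsilon>" using M(2)[of q] q by simp
    then have MN: "N' < M" using K[of M] M(1) by (meson atLeastAtMost_iff max.strict_boundedE not_le)
    have "H v \<le> H M + H M / 100 * ((M - v) / M)" if "v \<in> {max r0 0..M}" for v
    proof -
      have "H v \<le> H M" using M that by auto
      moreover have "0 \<le> H M / 100 * ((M - v) / M)"
        using HM \<epsilon> that MN by (intro mult_nonneg_nonneg divide_nonneg_nonneg) (auto simp: N'_def)
      ultimately show ?thesis by linarith
    qed
    then show "\<exists>M\<ge>N. \<epsilon> / 2 \<le> H M \<and>
        (\<forall>v\<in>{max r0 0..M}. H v \<le> H M + H M / 100 * ((M - v) / M))"
      using HM \<epsilon> MN by (intro exI[of _ M]) (auto simp: N'_def)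
  qed simp
next
  case True
  then obtain K where K: "\<And>v. 0 \<le> v \<Longrightarrow> H v \<le> K" by blast
  \<comment> \<open>The eventual upper bounds of H; their infimum L is the limit superior at
    infinity.\<close>
  define S where "S = {K. eventually (\<lambda>v. H v \<le> K) at_top}"
  have freq: "\<exists>v\<ge>N. H v > \<epsilon>" for N
  proof -
    have "eventually (\<lambda>n. N \<le> \<xi> n) sequentially" using \<xi> by (simp add: filterlim_at_top)
    then obtain n where "N \<le> \<xi> n" using eventually_happens'[OF sequentially_bot] by blast
    then show ?thesis using H\<xi>[of n] by blast
  qed
  have "K \<in> S" using K by (auto simp: S_def eventually_at_top_linorder)
  have Sb: "\<epsilon> \<le> k" if k: "k \<in> S" for k
  proof -
    obtain N where N: "\<And>v. N \<le> v \<Longrightarrow> H v \<le> k"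
      using k by (auto simp: S_def eventually_at_top_linorder)
    obtain v where "N \<le> v" "\<epsilon> < H v" using freq by blast
    then show ?thesis using N[of v] by simp
  qed
  define L where "L = Inf S"
  have L\<epsilon>: "\<epsilon> \<le> L" unfolding L_def using \<open>K \<in> S\<close> Sb by (intro cInf_greatest) auto
  \<comment> \<open>With 1010 the M found below has H M > L - \<sigma> = 1009 \<sigma>, so a tilt of
    slope 5 \<sigma> / q with M \<le> q costs no more than the slope H M / (100 M) that is
    allowed.\<close>
  define \<sigma> where "\<sigma> = L / 1010"
  have \<sigma>: "0 < \<sigma>" using L\<epsilon> \<epsilon> by (simp add: \<sigma>_def)
  obtain k where k: "k \<in> S" "k < L + \<sigma>"
    using cInf_lessD[of S "L + \<sigma>"] \<open>K \<in> S\<close> \<sigma> by (auto simp: L_def)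
  then obtain r1 where "\<And>v. r1 \<le> v \<Longrightarrow> H v \<le> k"
    by (auto simp: S_def eventually_at_top_linorder)
  then have r1: "\<And>v. r1 \<le> v \<Longrightarrow> H v \<le> L + \<sigma>" using k(2) by fastforce
  have "L \<le> k" if "k \<in> S" for k
    unfolding L_def by (rule cInf_lower[OF that]) (use Sb in \<open>auto simp: bdd_below_def\<close>)
  then have "L - \<sigma> \<notin> S" using \<sigma> by fastforce
  then have freqL: "\<exists>v\<ge>N. H v > L - \<sigma>" for N
    by (auto simp: S_def eventually_at_top_linorder not_le)
  define r where "r = max 0 (max r0 r1)"
  show ?thesis
  proof (rule exI[of _ r], intro conjI allI)
    show "r0 \<le> r" by (simp add: r_def)
    fix N :: real
    obtain q where q: "q \<ge> max (max (2 * N) (2 * r)) 1" "H q > L - \<sigma>" using freqL by blast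
    have q0: "0 < q" "r \<le> q" using q by (auto simp: r_def)
    \<comment> \<open>Tilting \<open>H\<close> linearly forces the maximum into \<open>[q/2, q]\<close> at the cost of a small slope.\<close>
    define F where "F v = H v + 5 * \<sigma> * v / q" for v
    have "continuous_on {r..q} F"
      unfolding F_def using q0 by (intro continuous_intros continuous_on_subset[OF Hc]) auto
    then obtain M where M: "M \<in> {r..q}" "\<And>v. v \<in> {r..q} \<Longrightarrow> F v \<le> F M"
      using continuous_attains_sup[of "{r..q}" F] q0 by auto
    have FM: "L - \<sigma> + 5 * \<sigma> < F M" using M(2)[of q] q q0 by (simp add: F_def)
    \<comment> \<open>In the left half F is at most L + \<sigma> + 5 \<sigma> / 2, which is below
      the level L + 4 \<sigma> that its maximum exceeds.\<close>
    have Mq: "q / 2 < M"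
    proof (rule ccontr)
      assume "\<not> q / 2 < M"
      then have "5 * \<sigma> * M / q \<le> 5 * \<sigma> / 2" using q0 \<sigma> by (simp add: field_simps)
      moreover have "H M \<le> L + \<sigma>" using r1 M by (auto simp: r_def)
      ultimately show False using FM \<sigma> unfolding F_def by argo
    qed
    have "5 * \<sigma> * M / q \<le> 5 * \<sigma>" using M q0 \<sigma> by (simp add: field_simps)
    then have HM: "L - \<sigma> < H M" using FM unfolding F_def by argo
    have HM': "500 * \<sigma> \<le> H M" using HM \<sigma> by (simp add: \<sigma>_def)
    have M0: "0 < M" using Mq q0 by simp
    have "H v \<le> H M + H M / 100 * ((M - v) / M)" if v: "v \<in> {r..M}" for v
    proof -
      have "F v \<le> F M" using M v by auto
      then have "H v \<le> H M + 5 * \<sigma> * ((M - v) / q)"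
        by (simp add: F_def algebra_simps diff_divide_distrib)
      also have "5 * \<sigma> * ((M - v) / q) \<le> H M / 100 * ((M - v) / M)"
        using HM' \<sigma> M v M0 q0 by (intro mult_mono divide_left_mono) auto
      finally show ?thesis by simp
    qed
    moreover have "\<epsilon> / 2 \<le> H M" using HM L\<epsilon> \<epsilon> by (simp add: \<sigma>_def)
    moreover have "N \<le> M" using Mq q by simp
    ultimately show "\<exists>M\<ge>N. \<epsilon> / 2 \<le> H M \<and>
        (\<forall>v\<in>{r..M}. H v \<le> H M + H M / 100 * ((M - v) / M))" by blast
  qed
qed

text \<open>Meant for the deviation U of a solution from M cos y, so that U'' + U = f.
  \<open>N1\<close> and \<open>N2\<close> are the variation-of-parameters coefficients, with
  derivatives f cos and f sin; integrating them from 0 gives the first bounds. The end condition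
  makes \<open>N1\<close> vanish at pi/2, and integrating it back from there gains decay at that
  end.\<close>

lemma duhamel_bounds:
  fixes U V f :: "real \<Rightarrow> real"
  assumes U: "\<And>y. y \<in> {0..pi/2} \<Longrightarrow> (U has_real_derivative V y) (at y)"
    and V: "\<And>y. y \<in> {0..pi/2} \<Longrightarrow> (V has_real_derivative f y - U y) (at y)"
    and f: "\<And>y. y \<in> {0..pi/2} \<Longrightarrow> \<bar>f y\<bar> \<le> B"
    and init: "U 0 = 0" "V 0 = 0"
    and y: "y \<in> {0..pi/2}"
  shows "\<bar>V y\<bar> \<le> B * sin y" and "\<bar>U y\<bar> \<le> B * (1 - cos y)"
    and "U (pi/2) = 0 \<Longrightarrow> \<bar>U y * sin y + V y * cos y\<bar> \<le> B * (cos y)\<^sup>2"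
    and "U (pi/2) = 0 \<Longrightarrow> \<bar>U y\<bar> \<le> 2 * B * cos y"
proof -
  have B: "0 \<le> B" using f[OF y] by linarith
  have sc: "0 \<le> sin y" "0 \<le> cos y" if "y \<in> {0..pi/2}" for y
    using that by (auto intro: sin_ge_zero cos_ge_zero)
  define N1 where "N1 y = U y * sin y + V y * cos y" for y
  define N2 where "N2 y = V y * sin y - U y * cos y" for y
  have N1: "(N1 has_real_derivative f y * cos y) (at y)" if "y \<in> {0..pi/2}" for y
    unfolding N1_def by (auto intro!: derivative_eq_intros U V that simp: algebra_simps)
  have N2: "(N2 has_real_derivative f y * sin y) (at y)" if "y \<in> {0..pi/2}" for y
    unfolding N2_def by (auto intro!: derivative_eq_intros U V that simp: algebra_simps)
  have N2b: "\<bar>N2 y\<bar> \<le> B * (1 - cos y)" if y: "y \<in> {0..pi/2}" for y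
  proof -
    have "\<bar>N2 y - N2 0\<bar> \<le> - (B * cos y) - - (B * cos 0)"
      by (rule abs_diff_le_of_abs_deriv_le[where F' = "\<lambda>y. f y * sin y" and G' = "\<lambda>y. B * sin y"])
        (use y f sc in \<open>auto intro!: N2 derivative_eq_intros mult_right_mono simp: abs_mult\<close>)
    then show ?thesis by (simp add: N2_def init algebra_simps)
  qed
  have N1b: "\<bar>N1 y\<bar> \<le> B * sin y" if y: "y \<in> {0..pi/2}" for y
  proof -
    have "\<bar>N1 y - N1 0\<bar> \<le> B * sin y - B * sin 0"
      by (rule abs_diff_le_of_abs_deriv_le[where F' = "\<lambda>y. f y * cos y" and G' = "\<lambda>y. B * cos y"])
        (use y f sc in \<open>auto intro!: N1 derivative_eq_intros mult_right_mono simp: abs_mult\<close>)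
    then show ?thesis by (simp add: N1_def init)
  qed
  have sq: "sin y * sin y + cos y * cos y = 1" for y :: real
    using sin_cos_squared_add3 by (simp add: add.commute)
  have UN: "U y = N1 y * sin y - N2 y * cos y" for y
    unfolding N1_def N2_def using sq[of y] by algebra
  have VN: "V y = N1 y * cos y + N2 y * sin y" for y
    unfolding N1_def N2_def using sq[of y] by algebra
  have Vb: "\<bar>V y\<bar> \<le> B * sin y" if y: "y \<in> {0..pi/2}" for y
  proof -
    have "\<bar>V y\<bar> \<le> \<bar>N1 y\<bar> * cos y + \<bar>N2 y\<bar> * sin y"
      unfolding VN using sc[OF y] abs_triangle_ineq by (metis abs_mult abs_of_nonneg)
    also have "\<dots> \<le> B * sin y * cos y + B * (1 - cos y) * sin y"
      using N1b[OF y] N2b[OF y] sc[OF y] by (intro add_mono mult_right_mono)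
    finally show ?thesis by (simp add: algebra_simps)
  qed
  then show "\<bar>V y\<bar> \<le> B * sin y" using y .
  have "\<bar>U y - U 0\<bar> \<le> - (B * cos y) - - (B * cos 0)"
    by (rule abs_diff_le_of_abs_deriv_le[where F' = V and G' = "\<lambda>y. B * sin y"])
      (use y Vb in \<open>auto intro!: U derivative_eq_intros\<close>)
  then show "\<bar>U y\<bar> \<le> B * (1 - cos y)" by (simp add: init algebra_simps)
  assume U1: "U (pi/2) = 0"
  have cos1: "cos y \<le> 1" by simp
  have "\<bar>N1 (pi/2) - N1 y\<bar> \<le> B * sin (pi/2) - B * sin y"
    by (rule abs_diff_le_of_abs_deriv_le[where F' = "\<lambda>y. f y * cos y" and G' = "\<lambda>y. B * cos y"])
      (use y f sc in \<open>auto intro!: N1 derivative_eq_intros mult_right_mono simp: abs_mult\<close>)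
  then have "\<bar>N1 y\<bar> \<le> B * (1 - sin y)" by (simp add: N1_def U1 algebra_simps)
  also have "\<dots> \<le> B * (cos y)\<^sup>2"
  proof (rule mult_left_mono[OF _ B])
    have "sin y * sin y \<le> sin y * 1" using sc[OF y] by (intro mult_left_mono) auto
    then show "1 - sin y \<le> (cos y)\<^sup>2" using sq[of y] by (simp add: power2_eq_square)
  qed
  finally have N1c: "\<bar>N1 y\<bar> \<le> B * (cos y)\<^sup>2" .
  then show "\<bar>U y * sin y + V y * cos y\<bar> \<le> B * (cos y)\<^sup>2" by (simp add: N1_def)
  have "\<bar>U y\<bar> \<le> \<bar>N1 y\<bar> * sin y + \<bar>N2 y\<bar> * cos y"
    unfolding UN using sc[OF y] abs_triangle_ineq4 by (metis abs_mult abs_of_nonneg)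
  also have "\<dots> \<le> B * (cos y)\<^sup>2 * 1 + B * (1 - cos y) * cos y"
    using N1c N2b[OF y] sc[OF y] by (intro add_mono mult_mono) auto
  also have "\<dots> \<le> 2 * B * cos y"
    using B sc[OF y] by (simp add: algebra_simps power2_eq_square)
  finally show "\<bar>U y\<bar> \<le> 2 * B * cos y" .
qed

text \<open>To be read with \<open>s = sin y\<close>, \<open>k = cos y\<close>, \<open>p = -u'(y)\<close>, where \<open>y\<close> is measured from the midpoint:
  \<open>q = k / (u p)\<close> turns \<open>d(H(u))\<close> into \<open>- g(u) cos y dy\<close>, and \<open>Q = -q'\<close>.\<close>

lemma weight_bounds:
  fixes B M s k u p f :: real
  assumes B: "0 \<le> B" and M: "0 < M" "20 * B \<le> M"
    and s: "0 < s" "s \<le> 1" and k: "0 < k" "k \<le> 1" "s\<^sup>2 + k\<^sup>2 = 1"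
    and u: "(M - 2 * B) * k \<le> u" "u \<le> (M + 2 * B) * k"
    and p: "(M - B) * s \<le> p" "p \<le> (M + B) * s"
    and N: "\<bar>s * u - k * p\<bar> \<le> B * k\<^sup>2" and f: "\<bar>f\<bar> \<le> B" and r: "3 * B \<le> r"
  defines "Q \<equiv> ((s * u - k * p) * p + k * u * (u - f)) / (u * p)\<^sup>2"
  shows "0 < u" "0 < p" "k / (u * p) \<le> 2 / (M\<^sup>2 * s)" "1 / (2 * M\<^sup>2) \<le> k / (u * p)"
    and "r \<le> u \<Longrightarrow> 0 \<le> Q \<and> Q \<le> 4 / (M\<^sup>2 * s\<^sup>2)"
    and "u \<le> r \<Longrightarrow> 4 * r \<le> M \<Longrightarrow> \<bar>Q\<bar> \<le> 64 * r / M ^ 3"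
proof -
  \<comment> \<open>Since 20 B \<le> M, the factors M - 2 B and M + 2 B lie between 9/10 and 11/10
    of M; the numerical constants below come from this.\<close>
  have u9: "9/10 * M * k \<le> u"
  proof -
    have "9/10 * M * k \<le> (M - 2 * B) * k" using M k by (intro mult_right_mono) auto
    with u show ?thesis by linarith
  qed
  have p9: "9/10 * M * s \<le> p"
  proof -
    have "9/10 * M * s \<le> (M - B) * s" using M s B by (intro mult_right_mono) auto
    with p show ?thesis by linarith
  qed
  have "0 < 9/10 * M * k" "0 < 9/10 * M * s" using M k s by auto
  then show u0: "0 < u" and p0: "0 < p" using u9 p9 by linarith+
  have "(9/10 * M * k) * (9/10 * M * s) \<le> u * p"
    using u9 p9 M k s u0 by (intro mult_mono) auto
  moreover have "(9/10 * M * k) * (9/10 * M * s) = 81/100 * (M\<^sup>2 * s * k)"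
    by (simp add: power2_eq_square)
  moreover have "0 \<le> M\<^sup>2 * s * k" using s k by simp
  ultimately have up: "M\<^sup>2 * s * k \<le> 2 * (u * p)" by linarith
  then show "k / (u * p) \<le> 2 / (M\<^sup>2 * s)" using u0 p0 M s by (simp add: field_simps)
  have "u * p \<le> (11/10 * M * k) * (11/10 * M)"
  proof (rule mult_mono)
    have "(M + 2 * B) * k \<le> 11/10 * M * k" using M k by (intro mult_right_mono) auto
    with u show "u \<le> 11/10 * M * k" by linarith
    have "(M + B) * s \<le> 11/10 * M * 1" using M s B by (intro mult_mono) auto
    with p show "p \<le> 11/10 * M" by simp
  qed (use u0 p0 M k in auto)
  also have "\<dots> \<le> 2 * M\<^sup>2 * k" using M k by (simp add: power2_eq_square)
  finally show "1 / (2 * M\<^sup>2) \<le> k / (u * p)" using u0 p0 M by (simp add: field_simps)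
  have kp: "k * p \<le> 2 * u"
  proof -
    have "k * p \<le> k * ((11/10 * M) * 1)"
    proof (rule mult_left_mono)
      have "(M + B) * s \<le> (11/10 * M) * 1" using M s B by (intro mult_mono) auto
      with p show "p \<le> (11/10 * M) * 1" by linarith
    qed (use k in simp)
    also have "\<dots> \<le> 2 * (9/10 * M * k)" using M k by simp
    finally show ?thesis using u9 by linarith
  qed
  \<comment> \<open>The combination \<open>s * u - k * p\<close> vanishes for the pure profile u = M
    cos y. Its smallness of order k^2 makes this part of the numerator comparable to k u.\<close>
  have Np: "\<bar>(s * u - k * p) * p\<bar> \<le> k * u * (2 * B)"
  proof -
    have "\<bar>(s * u - k * p) * p\<bar> \<le> B * k\<^sup>2 * p"
      unfolding abs_mult using N p0 by (simp add: mult_right_mono)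
    also have "\<dots> = B * k * (k * p)" by (simp add: power2_eq_square)
    also have "\<dots> \<le> B * k * (2 * u)" using kp B k by (intro mult_left_mono) auto
    finally show ?thesis by (simp add: algebra_simps)
  qed
  define n where "n = (s * u - k * p) * p + k * u * (u - f)"
  have Qn: "Q = n / (u * p)\<^sup>2" by (simp add: Q_def n_def)
  have ku: "0 < k * u" using k u0 by simp
  {
    \<comment> \<open>For u \<ge> r \<ge> 3 B the main factor u - f is at least 2 B and dominates
      the error, which gives the sign; u - f + 2 B \<le> 2 u gives the size.\<close>
    assume ru: "r \<le> u"
    have "k * u * (2 * B) \<le> k * u * (u - f)" using ku ru r f by (intro mult_left_mono) auto
    then have n0: "0 \<le> n" using Np unfolding n_def by linarith
    have "k * u * (u - f) + k * u * (2 * B) = k * u * (u - f + 2 * B)" by (simp add: algebra_simps)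
    also have "\<dots> \<le> k * u * (2 * u)" using ku ru r f by (intro mult_left_mono) auto
    also have "\<dots> \<le> 1 * u * (2 * u)" using k u0 by (intro mult_right_mono) auto
    finally have n1: "n \<le> 2 * u\<^sup>2" using Np unfolding n_def by (simp add: power2_eq_square)
    have "Q \<le> 2 * u\<^sup>2 / (u * p)\<^sup>2" unfolding Qn using n1 by (intro divide_right_mono) auto
    also have "\<dots> = 2 / p\<^sup>2" using u0 by (simp add: power_mult_distrib)
    also have "\<dots> \<le> 2 / (9/10 * M * s)\<^sup>2"
      using p9 M s by (intro divide_left_mono power_mono mult_pos_pos zero_less_power) (auto simp: p0)
    also have "\<dots> \<le> 4 / (M\<^sup>2 * s\<^sup>2)" using M s by (simp add: power_mult_distrib field_simps)
    finally show "0 \<le> Q \<and> Q \<le> 4 / (M\<^sup>2 * s\<^sup>2)" using n0 by (simp add: Qn)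
  }
  {
    \<comment> \<open>Here k is at most 1/2, so s is at least 1/2 and p at least M/4. No sign of
      \<open>Q\<close> is claimed in this region, only that it is of order r / M^3.\<close>
    assume ur: "u \<le> r" and rM: "4 * r \<le> M"
    have "9/10 * M * k \<le> 1/4 * M" using u9 ur rM by linarith
    then have "9/10 * k \<le> 1/4" using M by (simp add: field_simps)
    then have "k \<le> 1/2" by simp
    then have "k\<^sup>2 \<le> (1/2)\<^sup>2" using k by (intro power_mono) auto
    then have "(1/2)\<^sup>2 \<le> s\<^sup>2" using k(3) by (simp add: power2_eq_square)
    then have s2: "1/2 \<le> s" using s by (simp add: power2_le_iff_abs_le)
    have "9/10 * M * (1/2) \<le> 9/10 * M * s" using s2 M by (intro mult_left_mono) auto
    then have p4: "M / 4 \<le> p" using p9 M by linarith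
    have "\<bar>k * u * (u - f)\<bar> \<le> k * u * (r + B)"
      unfolding abs_mult using k u0 f ur by (intro mult_mono) auto
    then have "\<bar>n\<bar> \<le> k * u * (r + B) + k * u * (2 * B)" using Np unfolding n_def by linarith
    also have "\<dots> = k * u * (r + 3 * B)" by (simp add: algebra_simps)
    also have "\<dots> \<le> k * u * (2 * r)" using ku r by (intro mult_left_mono) auto
    finally have nb: "\<bar>n\<bar> \<le> k * u * (2 * r)" .
    have "\<bar>Q\<bar> = \<bar>n\<bar> / (u * p)\<^sup>2" by (simp add: Qn)
    also have "\<dots> \<le> k * u * (2 * r) / (u * p)\<^sup>2" using nb by (intro divide_right_mono) auto
    also have "\<dots> = (k / u) * (2 * r / p\<^sup>2)" using u0 by (simp add: power2_eq_square)
    also have "\<dots> \<le> (2 / M) * (2 * r / (M / 4)\<^sup>2)"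
    proof (rule mult_mono)
      have "M * k \<le> 2 * (9/10 * M * k)" using M k by simp
      then have "M * k \<le> 2 * u" using u9 by linarith
      then show "k / u \<le> 2 / M" using M u0 by (simp add: field_simps)
      show "2 * r / p\<^sup>2 \<le> 2 * r / (M / 4)\<^sup>2"
        using p4 M p0 r B by (intro divide_left_mono power_mono mult_pos_pos zero_less_power) auto
    qed (use M r B in auto)
    also have "\<dots> = 64 * r / M ^ 3" by (simp add: power2_eq_square power3_eq_cube)
    finally show "\<bar>Q\<bar> \<le> 64 * r / M ^ 3" .
  }
qed

text \<open>With \<Phi> = H(M) - H(u) the integrand is \<Phi>' q, and integration by parts leaves a
  boundary term at pi/2 plus the integral of \<Phi> Q. While u \<ge> r, Q is nonnegative and
  \<open>good\<close> makes \<Phi> almost nonnegative; where u < r the product is small, because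
  \<open>MD\<close> makes M large compared with r and D.\<close>

lemma sign_at_good_amplitude:
  fixes u u' f g H :: "real \<Rightarrow> real"
  assumes u: "\<And>y. y \<in> {0..pi/2} \<Longrightarrow> (u has_real_derivative u' y) (at y)"
    and u': "\<And>y. y \<in> {0..pi/2} \<Longrightarrow> (u' has_real_derivative f y - u y) (at y)"
    and f: "\<And>y. y \<in> {0..pi/2} \<Longrightarrow> \<bar>f y\<bar> \<le> B"
    and init: "u 0 = M" "u' 0 = 0" and bc: "u (pi/2) = 0"
    and gc: "continuous_on UNIV g" and gG: "\<And>t. \<bar>g t\<bar> \<le> G"
    and H: "\<And>t. (H has_real_derivative g t * t) (at t)" and H0: "H 0 = 0"
    and h: "0 < H M"
    and good: "\<And>v. v \<in> {r..M} \<Longrightarrow> H v \<le> H M + H M / 100 * ((M - v) / M)"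
    and D: "\<And>v. v \<in> {0..r} \<Longrightarrow> \<bar>H v\<bar> \<le> D"
    and r: "3 * B \<le> r" and M: "0 < M" "20 * B \<le> M" "4 * r \<le> M"
    and MD: "800 * r * (H M + D) \<le> M * H M"
  shows "0 < integral {0..pi/2} (\<lambda>y. g (u y) * cos y)"
proof -
  have B: "0 \<le> B" using f[of 0] by simp
  have G: "0 \<le> G" using gG[of 0] by linarith
  define U where "U y = u y - M * cos y" for y
  define V where "V y = u' y + M * sin y" for y
  define p where "p y = - u' y" for y
  define Q where "Q y = ((sin y * u y - cos y * p y) * p y + cos y * u y * (u y - f y)) / (u y * p y)\<^sup>2" for y
  define q where "q y = cos y / (u y * p y)" for y
  define \<Phi> where "\<Phi> y = H M - H (u y)" for y
  define J where "J y = integral {0..y} (\<lambda>y. g (u y) * cos y)" for y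
  \<comment> \<open>The loss allowed per unit length: the slack H M / 100 from \<open>good\<close>,
    times (M - u) / M \<le> 2 sin^2, times Q \<le> 4 / (M^2 sin^2). The 800 in \<open>MD\<close>
    makes the region u < r cost no more, as 64/800 = 8/100.\<close>
  define c where "c = 8/100 * H M / M\<^sup>2"
  have dU: "(U has_real_derivative V y) (at y)" if "y \<in> {0..pi/2}" for y
    unfolding U_def V_def by (auto intro!: derivative_eq_intros u that)
  have dV: "(V has_real_derivative f y - U y) (at y)" if "y \<in> {0..pi/2}" for y
    unfolding U_def V_def by (auto intro!: derivative_eq_intros u' that)
  have "U 0 = 0" "V 0 = 0" "U (pi/2) = 0" using init bc by (simp_all add: U_def V_def)
  note db = duhamel_bounds[OF dU dV f this(1,2)] and U1 = this(3)
  have sc: "0 < sin y" "0 < cos y" if "y \<in> {0<..<pi/2}" for y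
    using that by (auto intro: sin_gt_zero cos_gt_zero)
  have sc1: "1 - cos y \<le> (sin y)\<^sup>2" if "y \<in> {0<..<pi/2}" for y
  proof -
    have "cos y * cos y \<le> cos y * 1" using sc[OF that] by (intro mult_left_mono) auto
    then show ?thesis using sin_squared_eq[of y] by (simp add: power2_eq_square)
  qed
  have wb: "0 < u y" "0 < p y" "q y \<le> 2 / (M\<^sup>2 * sin y)" "1 / (2 * M\<^sup>2) \<le> q y"
    "r \<le> u y \<Longrightarrow> 0 \<le> Q y \<and> Q y \<le> 4 / (M\<^sup>2 * (sin y)\<^sup>2)"
    "u y \<le> r \<Longrightarrow> \<bar>Q y\<bar> \<le> 64 * r / M ^ 3" if y: "y \<in> {0<..<pi/2}" for y
  proof -
    have y': "y \<in> {0..pi/2}" using y by auto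
    have "\<bar>U y\<bar> \<le> 2 * B * cos y" by (rule db(4)[OF _ _ _ y' U1])
    then have ub: "(M - 2 * B) * cos y \<le> u y" "u y \<le> (M + 2 * B) * cos y"
      by (auto simp: U_def algebra_simps)
    have "\<bar>V y\<bar> \<le> B * sin y" by (rule db(1)[OF _ _ _ y'])
    then have pb: "(M - B) * sin y \<le> p y" "p y \<le> (M + B) * sin y"
      by (auto simp: V_def p_def algebra_simps)
    have "\<bar>U y * sin y + V y * cos y\<bar> \<le> B * (cos y)\<^sup>2" by (rule db(3)[OF _ _ _ y' U1])
    then have Nb: "\<bar>sin y * u y - cos y * p y\<bar> \<le> B * (cos y)\<^sup>2"
      by (simp add: U_def V_def p_def algebra_simps)
    note w = weight_bounds[OF B M(1,2) sc(1)[OF y] sin_le_one sc(2)[OF y] cos_le_one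
      sin_cos_squared_add ub pb Nb f[OF y'] r, folded Q_def q_def]
    show "0 < u y" "0 < p y" "q y \<le> 2 / (M\<^sup>2 * sin y)" "1 / (2 * M\<^sup>2) \<le> q y"
      "r \<le> u y \<Longrightarrow> 0 \<le> Q y \<and> Q y \<le> 4 / (M\<^sup>2 * (sin y)\<^sup>2)"
      "u y \<le> r \<Longrightarrow> \<bar>Q y\<bar> \<le> 64 * r / M ^ 3"
      using w M(3) by blast+
  qed
  \<comment> \<open>The factor sin^2 cancels the singularity of the bound on \<open>Q\<close> at the
    midpoint.\<close>
  have Mu: "0 \<le> M - u y" "M - u y \<le> 2 * M * (sin y)\<^sup>2" if y: "y \<in> {0<..<pi/2}" for y
  proof -
    have y': "y \<in> {0..pi/2}" using y by auto
    have Ub: "\<bar>U y\<bar> \<le> B * (1 - cos y)" by (rule db(2)[OF _ _ _ y'])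
    have "B * (1 - cos y) \<le> M * (1 - cos y)" using M B by (intro mult_right_mono) auto
    moreover have "M - u y = M * (1 - cos y) - U y" by (simp add: U_def algebra_simps)
    moreover have "2 * M * (1 - cos y) \<le> 2 * M * (sin y)\<^sup>2"
      using sc1[OF y] M by (intro mult_left_mono) auto
    ultimately show "0 \<le> M - u y" "M - u y \<le> 2 * M * (sin y)\<^sup>2" using Ub by linarith+
  qed
  have cM: "c = 8/100 * H M / M\<^sup>2" "0 < c" using h M by (simp_all add: c_def)
  have key: "0 \<le> \<Phi> y * Q y + c" if y: "y \<in> {0<..<pi/2}" for y
  proof (cases "r \<le> u y")
    case True
    note Q = wb(5)[OF y True]
    have "\<Phi> y \<ge> - (H M / 100 * ((M - u y) / M))"
      using good[of "u y"] True Mu(1)[OF y] by (simp add: \<Phi>_def)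
    moreover have "H M / 100 * ((M - u y) / M) \<le> H M / 100 * (2 * (sin y)\<^sup>2)"
      using Mu(2)[OF y] h M by (intro mult_left_mono) (auto simp: field_simps)
    ultimately have *: "- (H M / 100 * (2 * (sin y)\<^sup>2)) \<le> \<Phi> y" by linarith
    have "- c = - (H M / 100 * (2 * (sin y)\<^sup>2)) * (4 / (M\<^sup>2 * (sin y)\<^sup>2))"
      using sc[OF y] by (simp add: c_def)
    also have "\<dots> \<le> - (H M / 100 * (2 * (sin y)\<^sup>2)) * Q y"
      using Q h by (intro mult_left_mono_neg) (auto simp: mult_nonneg_nonneg)
    also have "\<dots> \<le> \<Phi> y * Q y" using * Q by (intro mult_right_mono) auto
    finally show ?thesis by simp
  next
    case False
    have Hu: "\<bar>H (u y)\<bar> \<le> D" using D False wb(1)[OF y] by auto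
    have "\<bar>\<Phi> y * Q y\<bar> \<le> (H M + D) * (64 * r / M ^ 3)"
      unfolding abs_mult using wb(6)[OF y] False Hu h by (intro mult_mono) (auto simp: \<Phi>_def)
    also have "\<dots> = 8/100 * (800 * r * (H M + D)) / M ^ 3" by simp
    also have "\<dots> \<le> 8/100 * (M * H M) / M ^ 3"
      using MD M by (intro divide_right_mono) auto
    also have "\<dots> = c" using M by (simp add: c_def power2_eq_square power3_eq_cube)
    finally show ?thesis by linarith
  qed
  have uc: "continuous_on {0..pi/2} u"
    by (rule DERIV_continuous_on[of _ _ u']) (use u has_field_derivative_at_within in blast)
  have Jc: "continuous_on {0..pi/2} (\<lambda>y. g (u y) * cos y)"
    by (intro continuous_intros continuous_on_compose2[OF gc uc]) auto
  \<comment> \<open>Since \<open>\<Phi>' q = g(u) cos\<close>, the derivative of \<open>J - \<Phi> q\<close> is \<open>-\<Phi> q'\<close>, and \<open>-\<Phi> q' \<ge> -c\<close> by \<open>key\<close>; the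
    boundary term \<open>H(M) q(\<pi>/2) \<ge> H(M) / (2M\<^sup>2)\<close> beats the total loss \<open>c \<pi>/2\<close>.\<close>
  define P where "P y = J y - \<Phi> y * q y + c * y" for y
  have dP: "(P has_real_derivative \<Phi> y * Q y + c) (at y)" if y: "y \<in> {0<..<pi/2}" for y
  proof -
    have y': "y \<in> {0..pi/2}" using y by auto
    have dJ: "(J has_real_derivative g (u y) * cos y) (at y)"
      using integral_has_real_derivative[OF Jc y'] y at_within_Icc_at[of 0 y "pi/2"]
      unfolding J_def by auto
    have dp: "(p has_real_derivative u y - f y) (at y)"
      unfolding p_def by (auto intro!: derivative_eq_intros u' y')
    have du: "(u has_real_derivative - p y) (at y)" using u[OF y'] by (simp add: p_def)
    have dq: "(q has_real_derivative - Q y) (at y)"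
      unfolding q_def
      by (rule derivative_eq_intros dp du refl)+
        (use wb(1,2)[OF y] in \<open>simp_all add: Q_def power2_eq_square algebra_simps diff_divide_distrib add_divide_distrib\<close>)
    have d\<Phi>: "(\<Phi> has_real_derivative g (u y) * u y * p y) (at y)"
      unfolding \<Phi>_def using DERIV_chain2[OF H du] by (auto intro!: derivative_eq_intros)
    have "g (u y) * u y * p y * q y = g (u y) * cos y"
      using wb(1,2)[OF y] by (simp add: q_def)
    then show ?thesis unfolding P_def
      by (auto intro!: derivative_eq_intros dJ dq d\<Phi> simp: algebra_simps)
  qed
  have Pmono: "P a \<le> P b" if ab: "0 < a" "a \<le> b" "b < pi/2" for a b
  proof (rule DERIV_nonneg_imp_nondecreasing[OF ab(2)])
    fix y assume "a \<le> y" "y \<le> b"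
    then have "y \<in> {0<..<pi/2}" using ab by auto
    then show "\<exists>d. (P has_real_derivative d) (at y) \<and> 0 \<le> d" using dP key by blast
  qed
  have HL: "\<bar>H M - H v\<bar> \<le> G * M * (M - v)" if v: "0 < v" "v \<le> M" for v
  proof -
    have "\<bar>H M - H v\<bar> \<le> G * M * M - G * M * v"
    proof (rule abs_diff_le_of_abs_deriv_le[OF v(2), of _ _ "\<lambda>x. G * M * x"])
      fix x assume x: "x \<in> {v..M}"
      show "(H has_real_derivative g x * x) (at x)" by (rule H)
      show "((\<lambda>x. G * M * x) has_real_derivative G * M) (at x)"
        by (auto intro!: derivative_eq_intros)
      show "\<bar>g x * x\<bar> \<le> G * M" unfolding abs_mult using gG x v G by (intro mult_mono) auto
    qed
    then show ?thesis by (simp add: algebra_simps)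
  qed
  \<comment> \<open>At the midpoint q may grow like 1/sin, but \<Phi> vanishes like sin^2, so both J
    and \<Phi> q are of order y, with constants G and 4 G. Hence the nondecreasing P starts from a
    nonnegative limit.\<close>
  have Plow: "- (5 * G * y) \<le> P y" if y: "y \<in> {0<..<pi/2}" for y
  proof -
    have siny: "sin y \<le> y" using sin_x_le_x y by auto
    have "\<bar>J y\<bar> \<le> G * y"
    proof -
      have "norm (integral {0..y} (\<lambda>y. g (u y) * cos y)) \<le> G * (y - 0)"
      proof (rule integral_bound)
        show "continuous_on {0..y} (\<lambda>y. g (u y) * cos y)"
          using y by (intro continuous_on_subset[OF Jc]) auto
        show "norm (g (u t) * cos t) \<le> G" for t
          using mult_mono[OF gG[of "u t"] abs_cos_le_one[of t]] G by (simp add: abs_mult)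
      qed (use y in auto)
      then show ?thesis by (simp add: J_def)
    qed
    moreover have "\<bar>\<Phi> y * q y\<bar> \<le> 4 * G * y"
    proof -
      have "\<bar>\<Phi> y\<bar> \<le> G * M * (M - u y)"
        unfolding \<Phi>_def using HL wb(1)[OF y] Mu(1)[OF y] by auto
      also have "\<dots> \<le> G * M * (2 * M * (sin y)\<^sup>2)"
        using Mu(2)[OF y] G M by (intro mult_left_mono) auto
      finally have \<Phi>b: "\<bar>\<Phi> y\<bar> \<le> G * M * (2 * M * (sin y)\<^sup>2)" .
      have q0: "0 \<le> q y" using wb(1,2)[OF y] sc[OF y] by (simp add: q_def)
      have "\<bar>\<Phi> y * q y\<bar> \<le> G * M * (2 * M * (sin y)\<^sup>2) * (2 / (M\<^sup>2 * sin y))"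
        unfolding abs_mult using \<Phi>b wb(3)[OF y] q0 G M by (intro mult_mono) auto
      also have "\<dots> = 4 * G * sin y" using sc[OF y] M by (simp add: power2_eq_square)
      also have "\<dots> \<le> 4 * G * y" using siny G by (intro mult_left_mono) auto
      finally show ?thesis .
    qed
    moreover have "0 \<le> c * y" using cM(2) y by (intro mult_nonneg_nonneg) auto
    ultimately have "- (G * y) - 4 * G * y \<le> P y" unfolding P_def by linarith
    then show ?thesis by simp
  qed
  have P0: "0 \<le> P y" if y: "y \<in> {0<..<pi/2}" for y
  proof (rule tendsto_upperbound)
    show "((\<lambda>t. - (5 * G * t)) \<longlongrightarrow> 0) (at_right 0)" by (auto intro!: tendsto_eq_intros)
    show "\<forall>\<^sub>F t in at_right 0. - (5 * G * t) \<le> P y"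
      unfolding eventually_at_right_field
    proof (intro exI[of _ y] conjI allI impI)
      fix t assume t: "0 < t" "t < y"
      then show "- (5 * G * t) \<le> P y" using Plow[of t] Pmono[of t y] y by auto
    qed (use y in auto)
  qed simp
  have dJ: "(J \<longlongrightarrow> J (pi/2)) (at_left (pi/2))"
  proof -
    have "continuous_on {0..pi/2} J"
      unfolding J_def using Jc by (intro indefinite_integral_continuous_1 integrable_continuous_real)
    then have "(J \<longlongrightarrow> J (pi/2)) (at (pi/2) within {0..pi/2})" by (simp add: continuous_on)
    then show ?thesis by (simp add: at_within_Icc_at_left)
  qed
  have "(u has_real_derivative u' (pi/2)) (at (pi/2))" by (rule u) simp
  from DERIV_isCont[OF DERIV_chain2[OF H this]] have "isCont \<Phi> (pi/2)"
    unfolding \<Phi>_def by (intro continuous_intros)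
  then have "(\<Phi> \<longlongrightarrow> \<Phi> (pi/2)) (at_left (pi/2))"
    by (simp add: isCont_def filterlim_at_split)
  then have \<Phi>l: "(\<Phi> \<longlongrightarrow> H M) (at_left (pi/2))" by (simp add: \<Phi>_def bc H0)
  \<comment> \<open>At pi/2 the quotient \<open>q\<close> is 0 / 0, hence 0 by convention, so the
    boundary term is obtained as a left limit with the lower bound 1 / (2 M^2) in place of
    \<open>q\<close>. The loss c y is at most 2 c as pi/2 < 2.\<close>
  have "H M / (2 * M\<^sup>2) - 2 * c \<le> J (pi/2)"
  proof (rule tendsto_le[OF _ dJ])
    show "((\<lambda>y. \<Phi> y / (2 * M\<^sup>2) - 2 * c) \<longlongrightarrow> H M / (2 * M\<^sup>2) - 2 * c) (at_left (pi/2))"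
      using M by (intro tendsto_intros \<Phi>l) auto
    have "\<forall>\<^sub>F y in at_left (pi/2). 0 < \<Phi> y" using order_tendstoD(1)[OF \<Phi>l h] .
    moreover have "\<forall>\<^sub>F y in at_left (pi/2). y \<in> {0<..<pi/2}"
      by (rule eventually_at_leftI[of 0]) auto
    ultimately show "\<forall>\<^sub>F y in at_left (pi/2). \<Phi> y / (2 * M\<^sup>2) - 2 * c \<le> J y"
    proof eventually_elim
      case (elim y)
      have "\<Phi> y * (1 / (2 * M\<^sup>2)) \<le> \<Phi> y * q y"
        using elim wb(4)[OF elim(2)] by (intro mult_left_mono) auto
      moreover have "c * y \<le> c * 2" using elim cM pi_less_4 by (intro mult_left_mono) auto
      ultimately show ?case using P0[OF elim(2)] unfolding P_def by simp
    qed
  qed simp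
  moreover have "2 * c < H M / (2 * M\<^sup>2)" using h M by (simp add: c_def field_simps)
  ultimately show ?thesis by (simp add: J_def)
qed

text \<open>The order of quantifiers matters: M depends on the trajectory only through the bound B,
  so one amplitude serves all trajectories that start from it.\<close>

lemma sign_at_arbitrarily_large_amplitude:
  fixes g H :: "real \<Rightarrow> real" and \<xi> :: "nat \<Rightarrow> real"
  assumes gc: "continuous_on UNIV g" and gG: "\<And>t. \<bar>g t\<bar> \<le> G"
    and H: "\<And>t. (H has_real_derivative g t * t) (at t)" and H0: "H 0 = 0"
    and \<xi>: "filterlim \<xi> at_top sequentially" and \<epsilon>: "0 < \<epsilon>" and H\<xi>: "\<And>n. H (\<xi> n) > \<epsilon>"
    and B: "0 \<le> B"
  shows "\<exists>M\<ge>N. \<forall>u u' f. (\<forall>y\<in>{0..pi/2}. (u has_real_derivative u' y) (at y)) \<longrightarrow>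
    (\<forall>y\<in>{0..pi/2}. (u' has_real_derivative f y - u y) (at y)) \<longrightarrow>
    (\<forall>y\<in>{0..pi/2}. \<bar>f y\<bar> \<le> B) \<longrightarrow> u 0 = M \<longrightarrow> u' 0 = 0 \<longrightarrow> u (pi/2) = 0 \<longrightarrow>
    0 < integral {0..pi/2} (\<lambda>y. g (u y) * cos y)"
proof -
  have Hc: "continuous_on UNIV H"
    by (rule DERIV_continuous_on[of _ _ "\<lambda>t. g t * t"]) (simp add: H)
  obtain r where r: "3 * B \<le> r"
    "\<And>N. \<exists>M\<ge>N. \<epsilon> / 2 \<le> H M \<and> (\<forall>v\<in>{r..M}. H v \<le> H M + H M / 100 * ((M - v) / M))"
    using good_amplitude[OF Hc \<xi> \<epsilon> H\<xi>, of "3 * B"] by blast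
  obtain D where D: "\<And>v. v \<in> {0..r} \<Longrightarrow> \<bar>H v\<bar> \<le> D"
    using compact_imp_bounded[OF compact_continuous_image[OF continuous_on_subset[OF Hc subset_UNIV] compact_Icc]]
    unfolding bounded_iff by (metis imageI real_norm_def)
  have r0: "0 \<le> r" using r(1) B by linarith
  have D0: "0 \<le> D" using D[of 0] r0 by simp
  \<comment> \<open>As H M \<ge> \<epsilon> / 2, one has D \<le> (2 D / \<epsilon>) H M, so the last
    entry yields the largeness condition \<open>MD\<close>.\<close>
  define N' where "N' = max (max N 1) (max (20 * B) (max (4 * r) (800 * r * (1 + 2 * D / \<epsilon>))))"
  obtain M where M: "N' \<le> M" "\<epsilon> / 2 \<le> H M"
    and good: "\<And>v. v \<in> {r..M} \<Longrightarrow> H v \<le> H M + H M / 100 * ((M - v) / M)"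
    using r(2)[of N'] by blast
  have h: "0 < H M" using M(2) \<epsilon> by linarith
  have MD: "800 * r * (H M + D) \<le> M * H M"
  proof -
    have "(\<epsilon> / 2) * (2 * D / \<epsilon>) \<le> H M * (2 * D / \<epsilon>)"
      using M(2) D0 \<epsilon> by (intro mult_right_mono) auto
    then have "D \<le> H M * (2 * D / \<epsilon>)" using \<epsilon> by simp
    then have "800 * r * (H M + D) \<le> 800 * r * (H M + H M * (2 * D / \<epsilon>))"
      using r0 by (intro mult_left_mono) auto
    also have "\<dots> = 800 * r * (1 + 2 * D / \<epsilon>) * H M" by (simp add: algebra_simps)
    also have "\<dots> \<le> M * H M" using M(1) h by (intro mult_right_mono) (auto simp: N'_def)
    finally show ?thesis .
  qed
  have "0 < integral {0..pi/2} (\<lambda>y. g (u y) * cos y)"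
    if "\<forall>y\<in>{0..pi/2}. (u has_real_derivative u' y) (at y)"
      "\<forall>y\<in>{0..pi/2}. (u' has_real_derivative f y - u y) (at y)"
      "\<forall>y\<in>{0..pi/2}. \<bar>f y\<bar> \<le> B" "u 0 = M" "u' 0 = 0" "u (pi/2) = 0" for u u' f
  proof (rule sign_at_good_amplitude[of u u' f B M g G H r D])
    show "20 * B \<le> M" "4 * r \<le> M" "0 < M" using M(1) by (auto simp: N'_def)
  qed (use that gc gG H H0 h good D r(1) MD in auto)
  then show ?thesis using M(1) by (intro exI[of _ M]) (auto simp: N'_def)
qed

section \<open>Shooting from the midpoint\<close>

lemma duhamel_split:
  fixes h :: "real \<Rightarrow> real"
  assumes "continuous_on {0..y} h"
  shows "integral {0..y} (\<lambda>t. sin (y - t) * h t)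
    = sin y * integral {0..y} (\<lambda>t. cos t * h t) - cos y * integral {0..y} (\<lambda>t. sin t * h t)"
proof -
  have "integral {0..y} (\<lambda>t. sin (y - t) * h t)
      = integral {0..y} (\<lambda>t. sin y * (cos t * h t) - cos y * (sin t * h t))"
    by (simp add: sin_diff algebra_simps)
  also have "\<dots> = integral {0..y} (\<lambda>t. sin y * (cos t * h t)) - integral {0..y} (\<lambda>t. cos y * (sin t * h t))"
    by (intro integral_diff integrable_continuous_real continuous_intros assms)
  finally show ?thesis by simp
qed

lemma duhamel_bound:
  fixes h :: "real \<Rightarrow> real"
  assumes "continuous_on {0..y} h" "0 \<le> y" "\<And>t. t \<in> {0..y} \<Longrightarrow> \<bar>h t\<bar> \<le> K"
  shows "\<bar>integral {0..y} (\<lambda>t. sin (y - t) * h t)\<bar> \<le> y * K"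
proof -
  have K: "0 \<le> K" using assms(3)[of 0] assms(2) by (simp add: order_trans[OF abs_ge_zero])
  have "norm (integral {0..y} (\<lambda>t. sin (y - t) * h t)) \<le> K * (y - 0)"
  proof (rule integral_bound[OF assms(2)])
    show "continuous_on {0..y} (\<lambda>t. sin (y - t) * h t)" by (intro continuous_intros assms)
    show "norm (sin (y - t) * h t) \<le> K" if "t \<in> {0..y}" for t
      using mult_mono[OF abs_sin_le_one[of "y - t"] assms(3)[OF that]] K by (simp add: abs_mult)
  qed
  then show ?thesis by (simp add: mult.commute)
qed

text \<open>Integrating L times the weight exp (2 L t) returns at most half of the weight. This is
  the contraction factor 1/2 in the weighted sup norm, on an interval of any length.\<close>

lemma duhamel_exp_bound:
  fixes h :: "real \<Rightarrow> real"
  assumes hc: "continuous_on {0..y} h" and y: "0 \<le> y" and L: "0 < L" and A: "0 \<le> A"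
    and h: "\<And>t. t \<in> {0..y} \<Longrightarrow> \<bar>h t\<bar> \<le> L * (A * exp (2 * L * t))"
  shows "\<bar>integral {0..y} (\<lambda>t. sin (y - t) * h t)\<bar> \<le> A / 2 * exp (2 * L * y)"
proof -
  have "((\<lambda>t. L * (A * exp (2 * L * t))) has_integral A / 2 * exp (2 * L * y) - A / 2 * exp (2 * L * 0)) {0..y}"
  proof (rule fundamental_theorem_of_calculus[OF y])
    fix t
    have "((\<lambda>t. A / 2 * exp (2 * L * t)) has_real_derivative L * (A * exp (2 * L * t))) (at t within {0..y})"
      by (auto intro!: derivative_eq_intros)
    then show "((\<lambda>t. A / 2 * exp (2 * L * t)) has_vector_derivative L * (A * exp (2 * L * t)))
        (at t within {0..y})"
      by (simp add: has_real_derivative_iff_has_vector_derivative)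
  qed
  then have I: "integral {0..y} (\<lambda>t. L * (A * exp (2 * L * t))) = A / 2 * exp (2 * L * y) - A / 2"
    by (subst integral_unique) simp_all
  have "norm (integral {0..y} (\<lambda>t. sin (y - t) * h t)) \<le> integral {0..y} (\<lambda>t. L * (A * exp (2 * L * t)))"
  proof (rule integral_norm_bound_integral)
    show "norm (sin (y - t) * h t) \<le> L * (A * exp (2 * L * t))" if "t \<in> {0..y}" for t
      using mult_mono[OF abs_sin_le_one[of "y - t"] h[OF that]] by (simp add: abs_mult)
  qed (intro integrable_continuous_real continuous_intros hc)+
  then show ?thesis using A unfolding I by simp
qed

text \<open>The variation-of-parameters form of u'' + u + g(u) = F with u(0) = M and u'(0) = 0; in
  integral form it asks only for continuity of u.\<close>

definition center_solution ::
    "(real \<Rightarrow> real) \<Rightarrow> real \<Rightarrow> (real \<Rightarrow> real) \<Rightarrow> real \<Rightarrow> (real \<Rightarrow> real) \<Rightarrow> bool" where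
  "center_solution g b F M u \<longleftrightarrow> continuous_on {0..b} u \<and>
     (\<forall>y\<in>{0..b}. u y = M * cos y + integral {0..y} (\<lambda>t. sin (y - t) * (F t - g (u t))))"

text \<open>Stated for the integral operator applied to an arbitrary continuous u: as g is bounded,
  the bound does not involve u. It confines Picard iterates and solutions alike to one interval, on
  which a single Lipschitz constant serves.\<close>

lemma center_solution_apriori:
  fixes g F u :: "real \<Rightarrow> real" and b :: real
  assumes gc: "continuous_on UNIV g" and gG: "\<And>t. \<bar>g t\<bar> \<le> G"
    and Fc: "continuous_on {0..b} F" and FE: "\<And>t. t \<in> {0..b} \<Longrightarrow> \<bar>F t\<bar> \<le> E"
    and uc: "continuous_on {0..b} u" and y: "y \<in> {0..b}"
  shows "\<bar>M * cos y + integral {0..y} (\<lambda>t. sin (y - t) * (F t - g (u t)))\<bar> \<le> \<bar>M\<bar> + b * (E + G)"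
proof -
  have "continuous_on {0..b} (\<lambda>t. F t - g (u t))"
    by (intro continuous_intros Fc continuous_on_compose2[OF gc uc]) auto
  then have "continuous_on {0..y} (\<lambda>t. F t - g (u t))"
    by (rule continuous_on_subset) (use y in auto)
  then have "\<bar>integral {0..y} (\<lambda>t. sin (y - t) * (F t - g (u t)))\<bar> \<le> y * (E + G)"
  proof (rule duhamel_bound)
    show "\<bar>F t - g (u t)\<bar> \<le> E + G" if "t \<in> {0..y}" for t
      using FE[of t] gG[of "u t"] that y by auto
  qed (use y in auto)
  also have "\<dots> \<le> b * (E + G)"
    using y FE[of y] gG[of 0] by (intro mult_right_mono) auto
  finally have "\<bar>integral {0..y} (\<lambda>t. sin (y - t) * (F t - g (u t)))\<bar> \<le> b * (E + G)" .
  moreover have "\<bar>M * cos y\<bar> \<le> \<bar>M\<bar> * 1" unfolding abs_mult by (intro mult_left_mono) auto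
  ultimately show ?thesis by linarith
qed

text \<open>Picard iteration: in the norm weighted by exp (2 L t) successive differences halve, so
  the telescoping series converges uniformly, and its limit is a fixed point.\<close>

lemma center_solution_exists:
  fixes g F :: "real \<Rightarrow> real" and b :: real
  assumes gc: "continuous_on UNIV g" and gG: "\<And>t. \<bar>g t\<bar> \<le> G"
    and gL: "\<And>R. \<exists>L>0. \<forall>s t. \<bar>s\<bar> \<le> R \<longrightarrow> \<bar>t\<bar> \<le> R \<longrightarrow> \<bar>g s - g t\<bar> \<le> L * \<bar>s - t\<bar>"
    and b: "0 \<le> b" and Fc: "continuous_on {0..b} F"
  shows "\<exists>u. center_solution g b F M u"
proof -
  obtain E where FE: "\<And>t. t \<in> {0..b} \<Longrightarrow> \<bar>F t\<bar> \<le> E"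
    using compact_imp_bounded[OF compact_continuous_image[OF Fc compact_Icc]]
    unfolding bounded_iff by (metis imageI real_norm_def)
  define R where "R = \<bar>M\<bar> + b * (E + G)"
  obtain L where L: "0 < L" "\<And>s t. \<bar>s\<bar> \<le> R \<Longrightarrow> \<bar>t\<bar> \<le> R \<Longrightarrow> \<bar>g s - g t\<bar> \<le> L * \<bar>s - t\<bar>"
    using gL[of R] by blast
  define T where "T u y = M * cos y + integral {0..y} (\<lambda>t. sin (y - t) * (F t - g (u t)))" for u y
  have hc: "continuous_on {0..b} (\<lambda>t. F t - g (u t))" if "continuous_on {0..b} u" for u
    by (intro continuous_intros Fc continuous_on_compose2[OF gc that]) auto
  have hcy: "continuous_on {0..y} (\<lambda>t. F t - g (u t))" if "continuous_on {0..b} u" "y \<in> {0..b}" for u y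
    by (rule continuous_on_subset[OF hc]) (use that in auto)
  have Tc: "continuous_on {0..b} (T u)" if u: "continuous_on {0..b} u" for u
  proof -
    \<comment> \<open>Splitting the kernel moves its dependence on y outside, leaving indefinite
      integrals whose continuity is known.\<close>
    have "continuous_on {0..b} (\<lambda>y. M * cos y + (sin y * integral {0..y} (\<lambda>t. cos t * (F t - g (u t)))
        - cos y * integral {0..y} (\<lambda>t. sin t * (F t - g (u t)))))"
      by (intro continuous_intros indefinite_integral_continuous_1 integrable_continuous_real hc u)
    then show ?thesis
      by (rule continuous_on_cong[THEN iffD1, rotated -1]) (simp_all add: T_def duhamel_split hcy[OF u])
  qed
  have TR: "\<bar>T u y\<bar> \<le> R" if "continuous_on {0..b} u" "y \<in> {0..b}" for u y
    unfolding T_def R_def by (rule center_solution_apriori[OF gc gG Fc FE that])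
  have TT: "\<bar>T u y - T v y\<bar> \<le> A / 2 * exp (2 * L * y)"
    if u: "continuous_on {0..b} u" "\<And>t. t \<in> {0..b} \<Longrightarrow> \<bar>u t\<bar> \<le> R"
      and v: "continuous_on {0..b} v" "\<And>t. t \<in> {0..b} \<Longrightarrow> \<bar>v t\<bar> \<le> R"
      and A: "0 \<le> A" "\<And>t. t \<in> {0..b} \<Longrightarrow> \<bar>u t - v t\<bar> \<le> A * exp (2 * L * t)"
      and y: "y \<in> {0..b}" for u v A y
  proof -
    have "T u y - T v y = integral {0..y} (\<lambda>t. sin (y - t) * (F t - g (u t)) - sin (y - t) * (F t - g (v t)))"
      unfolding T_def
      by (simp, intro integral_diff[symmetric] integrable_continuous_real continuous_on_mult hcy u v y continuous_intros)
    also have "\<dots> = integral {0..y} (\<lambda>t. sin (y - t) * ((F t - g (u t)) - (F t - g (v t))))"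
      by (simp add: algebra_simps)
    finally have "\<bar>T u y - T v y\<bar> = \<bar>integral {0..y} (\<lambda>t. sin (y - t) * ((F t - g (u t)) - (F t - g (v t))))\<bar>"
      by simp
    also have "\<dots> \<le> A / 2 * exp (2 * L * y)"
    proof (rule duhamel_exp_bound[OF _ _ L(1) A(1)])
      show "continuous_on {0..y} (\<lambda>t. (F t - g (u t)) - (F t - g (v t)))"
        by (intro continuous_on_diff[OF hcy hcy] u v y)
      fix t assume t: "t \<in> {0..y}"
      have "\<bar>(F t - g (u t)) - (F t - g (v t))\<bar> \<le> L * \<bar>u t - v t\<bar>"
        using L(2)[of "v t" "u t"] u(2)[of t] v(2)[of t] t y by (auto simp: abs_minus_commute)
      also have "\<dots> \<le> L * (A * exp (2 * L * t))"
        using A(2)[of t] t y L by (intro mult_left_mono) auto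
      finally show "\<bar>(F t - g (u t)) - (F t - g (v t))\<bar> \<le> L * (A * exp (2 * L * t))" .
    qed (use y in auto)
    finally show ?thesis .
  qed
  define w where "w n = (T ^^ n) (\<lambda>y. M * cos y)" for n
  have wS: "w (Suc n) = T (w n)" for n by (simp add: w_def)
  have R0: "0 \<le> R" using TR[of "\<lambda>_. 0" 0] b by auto
  have wc: "continuous_on {0..b} (w n)" for n
    by (induction n) (auto simp: wS Tc, auto simp: w_def intro!: continuous_intros)
  have wR: "\<bar>w n y\<bar> \<le> R" if y: "y \<in> {0..b}" for n y
  proof (cases n)
    case 0
    have "\<bar>M * cos y\<bar> \<le> \<bar>M\<bar> * 1" unfolding abs_mult by (intro mult_left_mono) auto
    moreover have "0 \<le> b * (E + G)" using b FE[OF y] gG[of 0] by (intro mult_nonneg_nonneg) auto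
    ultimately show ?thesis using 0 by (simp add: w_def R_def)
  qed (simp add: wS TR[OF wc y])
  have step: "\<bar>w (Suc n) y - w n y\<bar> \<le> 2 * R / 2 ^ n * exp (2 * L * y)" if "y \<in> {0..b}" for n y
    using that
  proof (induction n arbitrary: y)
    case 0
    have "2 * R * 1 \<le> 2 * R * exp (2 * L * y)" using R0 L 0 by (intro mult_left_mono) auto
    then show ?case using wR[OF 0, of 0] wR[OF 0, of 1] by simp
  next
    case (Suc n)
    have "\<bar>T (w (Suc n)) y - T (w n) y\<bar> \<le> (2 * R / 2 ^ n) / 2 * exp (2 * L * y)"
      by (rule TT[OF wc wR wc wR _ Suc.IH Suc.prems]) (use R0 in auto)
    then show ?case by (simp add: wS)
  qed
  define K where "K = 2 * R * exp (2 * L * b)"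
  have step': "norm (w (Suc n) y - w n y) \<le> K * (1/2) ^ n" if y: "y \<in> {0..b}" for n y
  proof -
    have "2 * R / 2 ^ n * exp (2 * L * y) \<le> 2 * R / 2 ^ n * exp (2 * L * b)"
      using y R0 L by (intro mult_left_mono) auto
    then show ?thesis using step[OF y, of n] by (simp add: K_def power_one_over)
  qed
  have unif: "uniform_limit {0..b} (\<lambda>n y. \<Sum>i<n. w (Suc i) y - w i y) (\<lambda>y. \<Sum>i. w (Suc i) y - w i y) sequentially"
    by (rule Weierstrass_m_test[OF step']) (auto intro!: summable_mult summable_geometric)
  have "uniform_limit {0..b} (\<lambda>n y. w n y - w 0 y) (\<lambda>y. \<Sum>i. w (Suc i) y - w i y) sequentially"
  proof -
    have "(\<Sum>i<n. w (Suc i) y - w i y) = w n y - w 0 y" for n y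
      using sum_lessThan_telescope[of "\<lambda>i. w i y" n] by simp
    then show ?thesis using unif by simp
  qed
  from uniform_limit_add[OF this, of "\<lambda>_. w 0" "w 0"]
  obtain u where ul: "uniform_limit {0..b} w u sequentially" by (auto simp: uniform_limit_const)
  have uc: "continuous_on {0..b} u"
    by (rule uniform_limit_theorem[OF _ ul]) (auto simp: wc)
  have wl: "(\<lambda>n. w n y) \<longlonglongrightarrow> u y" if "y \<in> {0..b}" for y
    by (rule tendsto_uniform_limitI[OF ul that])
  have uR: "\<bar>u y\<bar> \<le> R" if y: "y \<in> {0..b}" for y
    by (rule tendsto_upperbound[OF tendsto_rabs[OF wl[OF y]]]) (auto simp: wR[OF y])
  have "u y = T u y" if y: "y \<in> {0..b}" for y
  proof (rule LIMSEQ_unique[OF LIMSEQ_Suc[OF wl[OF y]]])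
    show "(\<lambda>n. w (Suc n) y) \<longlonglongrightarrow> T u y"
      unfolding LIMSEQ_iff
    proof (intro allI impI)
      fix r :: real assume r: "0 < r"
      \<comment> \<open>Scaled so that A exp (2 L b) = r; the contraction then leaves r / 2.\<close>
      define A where "A = r / exp (2 * L * b)"
      have A: "0 < A" using r by (simp add: A_def)
      from uniform_limitD[OF ul A] obtain N
        where N: "\<And>n t. N \<le> n \<Longrightarrow> t \<in> {0..b} \<Longrightarrow> \<bar>w n t - u t\<bar> < A"
        unfolding eventually_sequentially by (metis dist_real_def)
      have "norm (w (Suc n) y - T u y) < r" if n: "N \<le> n" for n
      proof -
        have "\<bar>T (w n) y - T u y\<bar> \<le> A / 2 * exp (2 * L * y)"
        proof (rule TT[OF wc wR uc uR _ _ y])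
          fix t assume t: "t \<in> {0..b}"
          have "A * 1 \<le> A * exp (2 * L * t)" using A t L by (intro mult_left_mono) auto
          then show "\<bar>w n t - u t\<bar> \<le> A * exp (2 * L * t)" using N[OF n t] by simp
        qed (use A in auto)
        also have "\<dots> \<le> A / 2 * exp (2 * L * b)" using A y L by (intro mult_left_mono) auto
        also have "\<dots> < r" using r by (simp add: A_def)
        finally show ?thesis by (simp add: wS)
      qed
      then show "\<exists>N. \<forall>n\<ge>N. norm (w (Suc n) y - T u y) < r" by blast
    qed
  qed
  then show ?thesis using uc unfolding center_solution_def T_def by blast
qed

text \<open>The weighted sup norm replaces Gronwall's inequality: at the point z where |u - v| exp
  (-2 L t) attains its maximum m, the nonlinear term contributes at most half of m and is absorbed
  on the left.\<close>

lemma center_solution_dependence: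
  fixes g F F' u v :: "real \<Rightarrow> real" and b :: real
  assumes gc: "continuous_on UNIV g"
    and L: "0 < L" "\<And>s t. \<bar>s\<bar> \<le> R \<Longrightarrow> \<bar>t\<bar> \<le> R \<Longrightarrow> \<bar>g s - g t\<bar> \<le> L * \<bar>s - t\<bar>"
    and b: "0 \<le> b" and Fc: "continuous_on {0..b} F" "continuous_on {0..b} F'"
    and FF: "\<And>t. t \<in> {0..b} \<Longrightarrow> \<bar>F t - F' t\<bar> \<le> d"
    and u: "center_solution g b F M u" "\<And>t. t \<in> {0..b} \<Longrightarrow> \<bar>u t\<bar> \<le> R"
    and v: "center_solution g b F' N v" "\<And>t. t \<in> {0..b} \<Longrightarrow> \<bar>v t\<bar> \<le> R"
    and y: "y \<in> {0..b}"
  shows "\<bar>u y - v y\<bar> \<le> 2 * (\<bar>M - N\<bar> + b * d) * exp (2 * L * b)"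
proof -
  have uc: "continuous_on {0..b} u" and vc: "continuous_on {0..b} v"
    using u v by (auto simp: center_solution_def)
  have "continuous_on {0..b} (\<lambda>t. \<bar>u t - v t\<bar> * exp (- (2 * L * t)))"
    by (intro continuous_intros uc vc)
  then obtain z where z: "z \<in> {0..b}"
    "\<And>t. t \<in> {0..b} \<Longrightarrow> \<bar>u t - v t\<bar> * exp (- (2 * L * t)) \<le> \<bar>u z - v z\<bar> * exp (- (2 * L * z))"
    using continuous_attains_sup[OF compact_Icc, of 0 b] b by fastforce
  define m where "m = \<bar>u z - v z\<bar> * exp (- (2 * L * z))"
  have m0: "0 \<le> m" by (simp add: m_def)
  have um: "\<bar>u t - v t\<bar> \<le> m * exp (2 * L * t)" if "t \<in> {0..b}" for t
  proof -
    have "\<bar>u t - v t\<bar> * exp (- (2 * L * t)) * exp (2 * L * t) \<le> m * exp (2 * L * t)"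
      using z(2)[OF that] unfolding m_def by (intro mult_right_mono) auto
    then show ?thesis by (simp add: mult.assoc flip: exp_add)
  qed
  have c: "continuous_on {0..z} F" "continuous_on {0..z} F'"
      "continuous_on {0..z} (\<lambda>t. g (u t))" "continuous_on {0..z} (\<lambda>t. g (v t))"
    using z(1) by (auto intro!: continuous_on_subset[OF Fc(1)] continuous_on_subset[OF Fc(2)]
        continuous_on_compose2[OF gc] continuous_on_subset[OF uc] continuous_on_subset[OF vc])
  have d0: "0 \<le> d" using FF[OF z(1)] by linarith
  let ?I = "\<lambda>h. integral {0..z} (\<lambda>t. sin (z - t) * h t)"
  have "u z - v z = (M - N) * cos z + (?I (\<lambda>t. F t - g (u t)) - ?I (\<lambda>t. F' t - g (v t)))"
    using u(1) v(1) z(1) by (simp add: center_solution_def algebra_simps)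
  also have "?I (\<lambda>t. F t - g (u t)) - ?I (\<lambda>t. F' t - g (v t))
      = integral {0..z} (\<lambda>t. sin (z - t) * (F t - g (u t)) - sin (z - t) * (F' t - g (v t)))"
    by (intro integral_diff[symmetric] integrable_continuous_real continuous_intros c)
  also have "\<dots> = integral {0..z} (\<lambda>t. sin (z - t) * (F t - F' t) + sin (z - t) * (g (v t) - g (u t)))"
    by (simp add: algebra_simps)
  also have "\<dots> = ?I (\<lambda>t. F t - F' t) + ?I (\<lambda>t. g (v t) - g (u t))"
    by (intro integral_add integrable_continuous_real continuous_intros c)
  finally have eq: "u z - v z = (M - N) * cos z + (?I (\<lambda>t. F t - F' t) + ?I (\<lambda>t. g (v t) - g (u t)))" .
  have "\<bar>?I (\<lambda>t. F t - F' t)\<bar> \<le> z * d"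
    by (rule duhamel_bound) (use z(1) FF in \<open>auto intro!: continuous_intros c\<close>)
  also have "\<dots> \<le> b * d" using z(1) d0 by (intro mult_right_mono) auto
  finally have I1: "\<bar>?I (\<lambda>t. F t - F' t)\<bar> \<le> b * d" .
  have I2: "\<bar>?I (\<lambda>t. g (v t) - g (u t))\<bar> \<le> m / 2 * exp (2 * L * z)"
  proof (rule duhamel_exp_bound[OF _ _ L(1) m0])
    fix t assume t: "t \<in> {0..z}"
    have "\<bar>g (v t) - g (u t)\<bar> \<le> L * \<bar>u t - v t\<bar>"
      using L(2)[of "v t" "u t"] u(2)[of t] v(2)[of t] t z(1) by (auto simp: abs_minus_commute)
    also have "\<dots> \<le> L * (m * exp (2 * L * t))"
      using um[of t] t z(1) L by (intro mult_left_mono) auto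
    finally show "\<bar>g (v t) - g (u t)\<bar> \<le> L * (m * exp (2 * L * t))" .
  qed (use z(1) in \<open>auto intro!: continuous_intros c\<close>)
  have "\<bar>(M - N) * cos z\<bar> \<le> \<bar>M - N\<bar> * 1" unfolding abs_mult by (intro mult_left_mono) auto
  then have I0: "\<bar>(M - N) * cos z\<bar> \<le> \<bar>M - N\<bar>" by (simp only: mult_1_right)
  have abs3: "\<bar>x\<bar> \<le> k1 + k2 + k3"
    if "x = x1 + (x2 + x3)" "\<bar>x1\<bar> \<le> k1" "\<bar>x2\<bar> \<le> k2" "\<bar>x3\<bar> \<le> k3" for x x1 x2 x3 k1 k2 k3 :: real
    using that by linarith
  have ez: "1 \<le> exp (2 * L * z)" using z(1) L by simp
  have "m * exp (2 * L * z) = \<bar>u z - v z\<bar>" by (simp add: m_def mult.assoc flip: exp_add)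
  also have "\<dots> \<le> \<bar>M - N\<bar> + b * d + m / 2 * exp (2 * L * z)" by (rule abs3[OF eq I0 I1 I2])
  also have "\<bar>M - N\<bar> + b * d \<le> (\<bar>M - N\<bar> + b * d) * exp (2 * L * z)"
    using mult_left_mono[OF ez, of "\<bar>M - N\<bar> + b * d"] b d0 by simp
  finally have "m * exp (2 * L * z) \<le> (\<bar>M - N\<bar> + b * d + m / 2) * exp (2 * L * z)"
    by (simp add: algebra_simps)
  then have "m \<le> \<bar>M - N\<bar> + b * d + m / 2" by (simp only: mult_le_cancel_right_pos exp_gt_zero)
  then have m: "m \<le> 2 * (\<bar>M - N\<bar> + b * d)" by simp
  have "\<bar>u y - v y\<bar> \<le> m * exp (2 * L * y)" by (rule um[OF y])
  also have "\<dots> \<le> 2 * (\<bar>M - N\<bar> + b * d) * exp (2 * L * b)"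
    using m m0 y L by (intro mult_mono) auto
  finally show ?thesis .
qed

text \<open>The half-interval solution becomes a function on the whole line with two-sided
  derivatives, in particular at 0 and b. The right-hand side is continued evenly with
  \<open>u\<close> frozen beyond b; variation of parameters with global primitives \<open>A\<close>
  and \<open>S\<close> then gives \<open>U\<close>, which is even because \<open>A\<close> is odd
  and \<open>S\<close> is even.\<close>

lemma even_lift:
  fixes g F :: "real \<Rightarrow> real"
  assumes gc: "continuous_on UNIV g" and Fc: "continuous_on UNIV F" and F: "\<And>t. F (- t) = F t"
    and b: "0 \<le> b" and u: "center_solution g b F M u"
  obtains U U' h :: "real \<Rightarrow> real"
  where "\<And>y. (U has_real_derivative U' y) (at y)"
    and "\<And>y. (U' has_real_derivative h y - U y) (at y)"
    and "continuous_on UNIV h"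
    and "\<And>y. \<bar>y\<bar> \<le> b \<Longrightarrow> h y = F y - g (U y)"
    and "\<And>y. U (- y) = U y" and "\<And>y. y \<in> {0..b} \<Longrightarrow> U y = u y" and "U 0 = M" and "U' 0 = 0"
proof -
  have uc: "continuous_on {0..b} u" using u by (simp add: center_solution_def)
  define h where "h t = F t - g (u (min \<bar>t\<bar> b))" for t
  have hc: "continuous_on UNIV h"
    unfolding h_def using b
    by (intro continuous_intros Fc continuous_on_compose2[OF gc] continuous_on_compose2[OF uc]) auto
  have heven: "h (- t) = h t" for t by (simp add: h_def F)
  have prim: "\<exists>A. (\<forall>x. (A has_real_derivative k x) (at x)) \<and> A 0 = 0"
    if k: "continuous_on UNIV k" for k :: "real \<Rightarrow> real"
  proof -
    obtain A where A: "\<And>x. (A has_vector_derivative k x) (at x)"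
      using einterval_antiderivative[of "-\<infinity>" "\<infinity>" k] k by (auto simp: continuous_on_eq_continuous_at)
    then have "\<And>x. ((\<lambda>x. A x - A 0) has_real_derivative k x) (at x)"
      by (auto simp: has_real_derivative_iff_has_vector_derivative intro!: derivative_eq_intros)
    then show ?thesis by (intro exI[of _ "\<lambda>x. A x - A 0"]) auto
  qed
  obtain A where A: "\<And>x. (A has_real_derivative cos x * h x) (at x)" "A 0 = 0"
    using prim[OF continuous_on_mult[OF continuous_on_cos[OF continuous_on_id] hc]] by auto
  obtain S where S: "\<And>x. (S has_real_derivative sin x * h x) (at x)" "S 0 = 0"
    using prim[OF continuous_on_mult[OF continuous_on_sin[OF continuous_on_id] hc]] by auto
  define U where "U y = M * cos y + (sin y * A y - cos y * S y)" for y
  define U' where "U' y = - M * sin y + (cos y * A y + sin y * S y)" for y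
  have dU: "(U has_real_derivative U' y) (at y)" for y
    unfolding U_def U'_def by (auto intro!: derivative_eq_intros A S simp: algebra_simps)
  have dU': "(U' has_real_derivative h y - U y) (at y)" for y
  proof -
    have "(U' has_real_derivative - M * cos y + (- sin y * A y + cos y * (cos y * h y)
        + (cos y * S y + sin y * (sin y * h y)))) (at y)"
      unfolding U'_def by (auto intro!: derivative_eq_intros A S)
    moreover have "- M * cos y + (- sin y * A y + cos y * (cos y * h y)
        + (cos y * S y + sin y * (sin y * h y))) = h y - U y"
      unfolding U_def using sin_cos_squared_add[of y] by algebra
    ultimately show ?thesis by simp
  qed
  have "A (- y) + A y = A (- 0) + A 0" for y
    by (rule DERIV_isconst_all)
      (auto intro!: derivative_eq_intros DERIV_chain2[OF A(1)] A simp: heven)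
  then have Ao: "A (- y) = - A y" for y using A(2) by (simp add: eq_neg_iff_add_eq_0)
  have "S (- y) - S y = S (- 0) - S 0" for y
    by (rule DERIV_isconst_all)
      (auto intro!: derivative_eq_intros DERIV_chain2[OF S(1)] S simp: heven)
  then have So: "S (- y) = S y" for y by simp
  have even: "U (- y) = U y" for y by (simp add: U_def Ao So)
  have Uu: "U y = u y" if y: "y \<in> {0..b}" for y
  proof -
    have FT: "integral {0..y} k = K y" if "\<And>x. (K has_real_derivative k x) (at x)" "K 0 = 0" for k K
      using fundamental_theorem_of_calculus[of 0 y K k] y that
      by (simp add: integral_unique has_real_derivative_iff_has_vector_derivative has_vector_derivative_at_within)
    have hy: "F t - g (u t) = h t" if "t \<in> {0..y}" for t using that y by (simp add: h_def)
    have "u y = M * cos y + integral {0..y} (\<lambda>t. sin (y - t) * (F t - g (u t)))"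
      using u y by (simp add: center_solution_def)
    also have "integral {0..y} (\<lambda>t. sin (y - t) * (F t - g (u t))) = integral {0..y} (\<lambda>t. sin (y - t) * h t)"
      by (rule integral_cong) (simp add: hy)
    also have "\<dots> = sin y * A y - cos y * S y"
      unfolding duhamel_split[OF continuous_on_subset[OF hc subset_UNIV]] FT[OF A] FT[OF S] ..
    finally show ?thesis by (simp add: U_def)
  qed
  have "h y = F y - g (U y)" if "\<bar>y\<bar> \<le> b" for y
  proof -
    have "U y = U \<bar>y\<bar>" using even by (simp add: abs_if)
    also have "\<dots> = u \<bar>y\<bar>" using that by (intro Uu) auto
    finally show ?thesis using that by (simp add: h_def)
  qed
  then show thesis
    by (intro that[of U U' h] dU dU' hc even Uu) (auto simp: U_def U'_def A S)
qed

section \<open>Classical solutions from explicit derivatives, and the endpoint map\<close>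

lemma Ck_on_2I:
  assumes "open S" "\<And>x. x \<in> S \<Longrightarrow> (f has_real_derivative f' x) (at x)"
    "\<And>x. x \<in> S \<Longrightarrow> (f' has_real_derivative f'' x) (at x)" "continuous_on S f''"
  shows "Ck_on 2 f S" and "\<And>x. x \<in> S \<Longrightarrow> deriv (deriv f) x = f'' x"
proof -
  have d1: "deriv f x = f' x" if "x \<in> S" for x by (rule DERIV_imp_deriv[OF assms(2)[OF that]])
  have dd: "(deriv f has_real_derivative f'' x) (at x)" if "x \<in> S" for x
    by (rule has_field_derivative_transform_within_open[OF assms(3)[OF that] assms(1) that])
      (simp add: d1)
  then show d2: "\<And>x. x \<in> S \<Longrightarrow> deriv (deriv f) x = f'' x" by (rule DERIV_imp_deriv)
  have c: "continuous_on S f" "continuous_on S (deriv f)"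
    by (rule DERIV_continuous_on[OF has_field_derivative_at_within], erule assms(2) dd)+
  have c2: "continuous_on S (deriv (deriv f))"
    by (rule continuous_on_cong[THEN iffD1, OF refl _ assms(4)]) (simp add: d2)
  show "Ck_on 2 f S"
    unfolding Ck_on_def
  proof (intro conjI allI impI ballI)
    fix j :: nat and x assume "j < 2" "x \<in> S"
    then show "(deriv ^^ j) f field_differentiable at x"
      using assms(2)[of x] dd[of x] unfolding less_2_cases_iff field_differentiable_def by fastforce
  next
    fix j :: nat assume "j \<le> 2"
    then consider "j = 0" | "j = 1" | "j = 2" by linarith
    then show "continuous_on S ((deriv ^^ j) f)"
      by cases (use c c2 in \<open>simp_all add: numeral_2_eq_2\<close>)
  qed
qed

text \<open>The problem with its midpoint moved to 0, where sin becomes cos;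
  \<open>\<epsilon>\<close> is the shifted forcing, continued evenly to the line. Evenness lets the
  orthogonality be stated on the half interval.\<close>

locale centered_problem =
  fixes g \<epsilon> :: "real \<Rightarrow> real" and G E :: real
  assumes gc: "continuous_on UNIV g" and gG: "\<bar>g t\<bar> \<le> G"
    and gL: "\<exists>L>0. \<forall>s t. \<bar>s\<bar> \<le> R \<longrightarrow> \<bar>t\<bar> \<le> R \<longrightarrow> \<bar>g s - g t\<bar> \<le> L * \<bar>s - t\<bar>"
    and \<epsilon>c: "continuous_on UNIV \<epsilon>" and \<epsilon>E: "\<bar>\<epsilon> t\<bar> \<le> E" and \<epsilon>_even: "\<epsilon> (- t) = \<epsilon> t"
    and \<epsilon>_orth: "integral {0..pi/2} (\<lambda>t. cos t * \<epsilon> t) = 0"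
begin

text \<open>By \<open>center_solution_dependence\<close> with equal data, the values on
  \<open>{0..pi/2}\<close> do not depend on the choice made here.\<close>

definition sol :: "real \<Rightarrow> real \<Rightarrow> real \<Rightarrow> real" where
  "sol M \<mu> = (SOME u. center_solution g (pi/2) (\<lambda>t. \<mu> * cos t + \<epsilon> t) M u)"

definition endpoint :: "real \<Rightarrow> real \<Rightarrow> real" where
  "endpoint M \<mu> = sol M \<mu> (pi/2)"

lemma forcing_continuous: "continuous_on A (\<lambda>t. \<mu> * cos t + \<epsilon> t)"
  by (intro continuous_intros continuous_on_subset[OF \<epsilon>c]) auto

lemma forcing_bound: "\<bar>\<mu> * cos t + \<epsilon> t\<bar> \<le> \<bar>\<mu>\<bar> + E"
proof -
  have "\<bar>\<mu> * cos t\<bar> \<le> \<bar>\<mu>\<bar> * 1" unfolding abs_mult by (intro mult_left_mono) auto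
  then show ?thesis using \<epsilon>E[of t] by linarith
qed

lemma sol: "center_solution g (pi/2) (\<lambda>t. \<mu> * cos t + \<epsilon> t) M (sol M \<mu>)"
proof -
  have "\<exists>u. center_solution g (pi/2) (\<lambda>t. \<mu> * cos t + \<epsilon> t) M u"
    by (rule center_solution_exists[OF gc gG gL _ forcing_continuous]) simp
  then show ?thesis unfolding sol_def by (rule someI_ex)
qed

lemma sol_continuous: "continuous_on {0..pi/2} (sol M \<mu>)"
  using sol by (simp add: center_solution_def)

lemma G_nonneg: "0 \<le> G" and E_nonneg: "0 \<le> E"
  using gG[of 0] \<epsilon>E[of 0] by linarith+

lemma sol_bound:
  assumes "y \<in> {0..pi/2}"
  shows "\<bar>sol M \<mu> y\<bar> \<le> \<bar>M\<bar> + pi/2 * (\<bar>\<mu>\<bar> + E + G)"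
  using center_solution_apriori[OF gc gG forcing_continuous forcing_bound sol_continuous assms]
    sol[of \<mu> M] assms
  by (auto simp: center_solution_def)

text \<open>At pi/2 the kernel sin (pi/2 - t) is cos t and M cos y vanishes; orthogonality removes
  \<epsilon>, and cos^2 integrates to pi/4. The shooting condition is thus the equation projected
  onto the first harmonic.\<close>

lemma endpoint_eq:
  "endpoint M \<mu> = \<mu> * (pi / 4) - integral {0..pi/2} (\<lambda>t. g (sol M \<mu> t) * cos t)"
proof -
  have c: "continuous_on {0..pi/2} (\<lambda>t. g (sol M \<mu> t))" "continuous_on {0..pi/2} \<epsilon>"
    by (auto intro: continuous_on_compose2[OF gc sol_continuous] continuous_on_subset[OF \<epsilon>c])
  have "((\<lambda>t. (cos t)\<^sup>2) has_integral
      ((\<lambda>x. (x + sin x * cos x) / 2) (pi/2) - (\<lambda>x. (x + sin x * cos x) / 2) 0)) {0..pi/2}"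
  proof (rule fundamental_theorem_of_calculus)
    fix x :: real
    have "((\<lambda>x. (x + sin x * cos x) / 2) has_real_derivative (cos x)\<^sup>2) (at x within {0..pi/2})"
      using sin_squared_eq[of x] by (auto intro!: derivative_eq_intros simp: power2_eq_square)
    then show "((\<lambda>x. (x + sin x * cos x) / 2) has_vector_derivative (cos x)\<^sup>2)
        (at x within {0..pi/2})"
      by (simp add: has_real_derivative_iff_has_vector_derivative)
  qed simp
  then have cos2: "integral {0..pi/2} (\<lambda>t. (cos t)\<^sup>2) = pi / 4" by (simp add: integral_unique)
  have "endpoint M \<mu> = integral {0..pi/2} (\<lambda>t. sin (pi/2 - t) * ((\<mu> * cos t + \<epsilon> t) - g (sol M \<mu> t)))"
    using sol[of \<mu> M] by (simp add: center_solution_def endpoint_def)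
  also have "\<dots> = integral {0..pi/2} (\<lambda>t. (\<mu> * (cos t)\<^sup>2 + cos t * \<epsilon> t) - g (sol M \<mu> t) * cos t)"
    by (rule integral_cong) (simp add: sin_diff algebra_simps power2_eq_square)
  also have "\<dots> = integral {0..pi/2} (\<lambda>t. \<mu> * (cos t)\<^sup>2 + cos t * \<epsilon> t)
      - integral {0..pi/2} (\<lambda>t. g (sol M \<mu> t) * cos t)"
    by (intro integral_diff integrable_continuous_real continuous_intros c)
  also have "integral {0..pi/2} (\<lambda>t. \<mu> * (cos t)\<^sup>2 + cos t * \<epsilon> t)
      = integral {0..pi/2} (\<lambda>t. \<mu> * (cos t)\<^sup>2) + integral {0..pi/2} (\<lambda>t. cos t * \<epsilon> t)"
    by (intro integral_add integrable_continuous_real continuous_intros c)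
  finally show ?thesis by (simp add: \<epsilon>_orth cos2)
qed

lemma reaction_bound: "\<bar>integral {0..pi/2} (\<lambda>t. g (sol M \<mu> t) * cos t)\<bar> \<le> G * (pi/2)"
proof -
  have "norm (integral {0..pi/2} (\<lambda>t. g (sol M \<mu> t) * cos t)) \<le> G * (pi/2 - 0)"
  proof (rule integral_bound)
    show "continuous_on {0..pi/2} (\<lambda>t. g (sol M \<mu> t) * cos t)"
      by (intro continuous_intros continuous_on_compose2[OF gc sol_continuous]) auto
    show "norm (g (sol M \<mu> t) * cos t) \<le> G" for t
      using mult_mono[OF gG[of "sol M \<mu> t"] abs_cos_le_one[of t]] G_nonneg by (simp add: abs_mult)
  qed simp
  then show ?thesis by simp
qed

lemma endpoint_zero_bound:
  assumes "endpoint M \<mu> = 0"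
  shows "\<bar>\<mu>\<bar> \<le> 2 * G"
proof -
  have "\<bar>\<mu> * (pi / 4)\<bar> \<le> G * (pi / 2)"
    using reaction_bound[of M \<mu>] assms unfolding endpoint_eq by simp
  then have "\<bar>\<mu>\<bar> * (pi / 4) \<le> (2 * G) * (pi / 4)" by (simp add: abs_mult)
  then show ?thesis by (rule mult_right_le_imp_le) simp
qed

text \<open>The integral term is at most G pi/2 = 2 G (pi/4) in absolute value, so for |\<mu>| > 2 G
  the linear term in \<mu> decides the sign.\<close>

lemma endpoint_large:
  shows "0 < endpoint M (2 * G + 1)" and "endpoint M (- (2 * G + 1)) < 0"
proof -
  have *: "(2 * G + 1) * (pi / 4) = G * (pi / 2) + pi / 4" by (simp add: algebra_simps)
  show "0 < endpoint M (2 * G + 1)"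
    using reaction_bound[of M "2 * G + 1"] pi_gt_zero unfolding endpoint_eq * by linarith
  show "endpoint M (- (2 * G + 1)) < 0"
    using reaction_bound[of M "- (2 * G + 1)"] pi_gt_zero
    unfolding endpoint_eq minus_mult_left[symmetric] * by linarith
qed

text \<open>For parameters bounded by K all solutions stay in one interval [-R, R], so a single
  Lipschitz constant of g gives joint dependence on M and \<mu>.\<close>

lemma endpoint_lipschitz:
  "\<exists>C\<ge>0. \<forall>M N \<mu> \<nu>. \<bar>M\<bar> \<le> K \<longrightarrow> \<bar>N\<bar> \<le> K \<longrightarrow> \<bar>\<mu>\<bar> \<le> K \<longrightarrow> \<bar>\<nu>\<bar> \<le> K \<longrightarrow>
    \<bar>endpoint M \<mu> - endpoint N \<nu>\<bar> \<le> C * (\<bar>M - N\<bar> + pi/2 * \<bar>\<mu> - \<nu>\<bar>)"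
proof -
  define R where "R = K + pi/2 * (K + E + G)"
  obtain L where L: "0 < L" "\<And>s t. \<bar>s\<bar> \<le> R \<Longrightarrow> \<bar>t\<bar> \<le> R \<Longrightarrow> \<bar>g s - g t\<bar> \<le> L * \<bar>s - t\<bar>"
    using gL[of R] by blast
  have R: "\<bar>sol M \<mu> y\<bar> \<le> R" if "\<bar>M\<bar> \<le> K" "\<bar>\<mu>\<bar> \<le> K" "y \<in> {0..pi/2}" for M \<mu> y
  proof -
    have "pi/2 * (\<bar>\<mu>\<bar> + E + G) \<le> pi/2 * (K + E + G)" using that by (intro mult_left_mono) auto
    then show ?thesis using sol_bound[OF that(3), of M \<mu>] that(1) unfolding R_def by linarith
  qed
  have "\<bar>endpoint M \<mu> - endpoint N \<nu>\<bar> \<le> 2 * exp (2 * L * (pi/2)) * (\<bar>M - N\<bar> + pi/2 * \<bar>\<mu> - \<nu>\<bar>)"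
    if K: "\<bar>M\<bar> \<le> K" "\<bar>N\<bar> \<le> K" "\<bar>\<mu>\<bar> \<le> K" "\<bar>\<nu>\<bar> \<le> K" for M N \<mu> \<nu>
  proof -
    have d: "\<bar>(\<mu> * cos t + \<epsilon> t) - (\<nu> * cos t + \<epsilon> t)\<bar> \<le> \<bar>\<mu> - \<nu>\<bar>" for t
    proof -
      have "(\<mu> * cos t + \<epsilon> t) - (\<nu> * cos t + \<epsilon> t) = (\<mu> - \<nu>) * cos t" by (simp add: algebra_simps)
      also have "\<bar>\<dots>\<bar> \<le> \<bar>\<mu> - \<nu>\<bar> * 1" unfolding abs_mult by (intro mult_left_mono) auto
      finally show ?thesis by simp
    qed
    have "\<bar>endpoint M \<mu> - endpoint N \<nu>\<bar> \<le> 2 * (\<bar>M - N\<bar> + pi/2 * \<bar>\<mu> - \<nu>\<bar>) * exp (2 * L * (pi/2))"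
      unfolding endpoint_def
      by (rule center_solution_dependence[OF gc L _ forcing_continuous forcing_continuous d
            sol R[OF K(1,3)] sol R[OF K(2,4)]]) auto
    then show ?thesis by (simp add: algebra_simps)
  qed
  then show ?thesis by (intro exI[of _ "2 * exp (2 * L * (pi/2))"]) auto
qed

lemma endpoint_continuous:
  shows "continuous_on {a..b} (\<lambda>M. endpoint M \<mu>)" and "continuous_on {a..b} (endpoint M)"
proof -
  define K where "K = \<bar>a\<bar> + \<bar>b\<bar> + \<bar>\<mu>\<bar> + \<bar>M\<bar>"
  obtain C where C: "0 \<le> C"
    "\<And>M N \<mu> \<nu>. \<bar>M\<bar> \<le> K \<Longrightarrow> \<bar>N\<bar> \<le> K \<Longrightarrow> \<bar>\<mu>\<bar> \<le> K \<Longrightarrow> \<bar>\<nu>\<bar> \<le> K \<Longrightarrow>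
      \<bar>endpoint M \<mu> - endpoint N \<nu>\<bar> \<le> C * (\<bar>M - N\<bar> + pi/2 * \<bar>\<mu> - \<nu>\<bar>)"
    using endpoint_lipschitz[of K] by blast
  have "C-lipschitz_on {a..b} (\<lambda>M. endpoint M \<mu>)"
  proof (rule lipschitz_onI[OF _ C(1)])
    fix x y assume "x \<in> {a..b}" "y \<in> {a..b}"
    then show "dist (endpoint x \<mu>) (endpoint y \<mu>) \<le> C * dist x y"
      using C(2)[of x y \<mu> \<mu>] by (auto simp: K_def dist_real_def)
  qed
  then show "continuous_on {a..b} (\<lambda>M. endpoint M \<mu>)" by (rule lipschitz_on_continuous_on)
  have "(C * (pi/2))-lipschitz_on {a..b} (endpoint M)"
  proof (rule lipschitz_onI)
    fix x y assume "x \<in> {a..b}" "y \<in> {a..b}"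
    then show "dist (endpoint M x) (endpoint M y) \<le> C * (pi/2) * dist x y"
      using C(2)[of M M x y] by (auto simp: K_def dist_real_def mult.assoc)
  qed (use C(1) in simp)
  then show "continuous_on {a..b} (endpoint M)" by (rule lipschitz_on_continuous_on)
qed

lemma endpoint_zero_between:
  assumes "a \<le> b" "endpoint M a \<le> 0" "0 \<le> endpoint M b"
  obtains \<mu> where "a \<le> \<mu>" "\<mu> \<le> b" "endpoint M \<mu> = 0"
  using IVT'[of "endpoint M" a 0 b] assms endpoint_continuous(2) by blast

lemma endpoint_zero_exists: "\<exists>\<mu>. endpoint M \<mu> = 0"
  by (rule endpoint_zero_between[of "- (2 * G + 1)" "2 * G + 1" M])
    (use endpoint_large[of M] G_nonneg in auto)

text \<open>If the endpoint value at \<mu> = 0 were nonnegative, the intermediate value theorem on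
  [-(2 G + 1), 0] would produce a zero \<mu> \<le> 0. The hypothesis speaks of all zeros because the
  argument does not control which one it finds.\<close>

lemma endpoint_neg_if_zeros_pos:
  assumes "\<And>\<mu>. endpoint M \<mu> = 0 \<Longrightarrow> 0 < \<mu>"
  shows "endpoint M 0 < 0"
proof (rule ccontr)
  assume "\<not> endpoint M 0 < 0"
  then obtain \<mu> where "\<mu> \<le> 0" "endpoint M \<mu> = 0"
    using endpoint_zero_between[of "- (2 * G + 1)" 0 M] endpoint_large[of M] G_nonneg by force
  then show False using assms by force
qed

lemma endpoint_pos_if_zeros_neg:
  assumes "\<And>\<mu>. endpoint M \<mu> = 0 \<Longrightarrow> \<mu> < 0"
  shows "0 < endpoint M 0"
proof (rule ccontr)
  assume "\<not> 0 < endpoint M 0"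
  then obtain \<mu> where "0 \<le> \<mu>" "endpoint M \<mu> = 0"
    using endpoint_zero_between[of 0 "2 * G + 1" M] endpoint_large[of M] G_nonneg by force
  then show False using assms by force
qed

text \<open>At a zero |\<mu>| \<le> 2 G, so the bound 3 G + E on the forcing depends on neither M
  nor \<mu>; this is what lets the amplitude be chosen before the solution.\<close>

lemma even_solution:
  assumes "endpoint M \<mu> = 0"
  obtains U U' h :: "real \<Rightarrow> real"
  where "\<And>y. (U has_real_derivative U' y) (at y)"
    and "\<And>y. (U' has_real_derivative h y - U y) (at y)"
    and "continuous_on UNIV h"
    and "\<And>y. \<bar>y\<bar> \<le> pi/2 \<Longrightarrow> h y = (\<mu> * cos y + \<epsilon> y) - g (U y)"
    and "\<And>y. \<bar>y\<bar> \<le> pi/2 \<Longrightarrow> \<bar>h y\<bar> \<le> 3 * G + E"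
    and "\<And>y. U (- y) = U y" and "U 0 = M" and "U' 0 = 0" and "U (pi/2) = 0"
    and "integral {0..pi/2} (\<lambda>y. g (U y) * cos y) = \<mu> * (pi / 4)"
proof -
  obtain U U' h where U: "\<And>y. (U has_real_derivative U' y) (at y)"
    "\<And>y. (U' has_real_derivative h y - U y) (at y)"
    "continuous_on UNIV h"
    "\<And>y. \<bar>y\<bar> \<le> pi/2 \<Longrightarrow> h y = (\<mu> * cos y + \<epsilon> y) - g (U y)"
    "\<And>y. U (- y) = U y" "\<And>y. y \<in> {0..pi/2} \<Longrightarrow> U y = sol M \<mu> y" "U 0 = M" "U' 0 = 0"
    by (rule even_lift[OF gc forcing_continuous _ _ sol, of \<mu> M]) (auto simp: \<epsilon>_even)
  have hb: "\<bar>h y\<bar> \<le> 3 * G + E" if "\<bar>y\<bar> \<le> pi/2" for y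
    using U(4)[OF that] forcing_bound[of \<mu> y] gG[of "U y"] endpoint_zero_bound[OF assms] by linarith
  have "integral {0..pi/2} (\<lambda>y. g (U y) * cos y) = integral {0..pi/2} (\<lambda>t. g (sol M \<mu> t) * cos t)"
    by (rule integral_cong) (simp add: U(6))
  then have "integral {0..pi/2} (\<lambda>y. g (U y) * cos y) = \<mu> * (pi / 4)"
    using assms by (simp add: endpoint_eq)
  then show thesis
    by (intro that[of U U' h] U hb) (use U(6)[of "pi/2"] assms in \<open>auto simp: endpoint_def\<close>)
qed

lemma zeros_positive:
  assumes "\<And>t. (H has_real_derivative g t * t) (at t)" "H 0 = 0"
    and "filterlim \<xi> at_top sequentially" "0 < \<delta>" "\<And>n. \<delta> < H (\<xi> n)"
  shows "\<exists>M\<ge>N. \<forall>\<mu>. endpoint M \<mu> = 0 \<longrightarrow> 0 < \<mu>"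
proof -
  obtain M where M: "N \<le> M" and pos: "\<And>u u' f. (\<forall>y\<in>{0..pi/2}. (u has_real_derivative u' y) (at y)) \<Longrightarrow>
    (\<forall>y\<in>{0..pi/2}. (u' has_real_derivative f y - u y) (at y)) \<Longrightarrow>
    (\<forall>y\<in>{0..pi/2}. \<bar>f y\<bar> \<le> 3 * G + E) \<Longrightarrow> u 0 = M \<Longrightarrow> u' 0 = 0 \<Longrightarrow> u (pi/2) = 0 \<Longrightarrow>
    0 < integral {0..pi/2} (\<lambda>y. g (u y) * cos y)"
    using sign_at_arbitrarily_large_amplitude[OF gc gG assms, of "3 * G + E" N] G_nonneg E_nonneg
    by auto
  have "0 < \<mu>" if "endpoint M \<mu> = 0" for \<mu>
  proof (rule even_solution[OF that])
    fix U U' h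
    assume "\<And>y. (U has_real_derivative U' y) (at y)" "\<And>y. (U' has_real_derivative h y - U y) (at y)"
      "\<And>y. \<bar>y\<bar> \<le> pi/2 \<Longrightarrow> \<bar>h y\<bar> \<le> 3 * G + E" "U 0 = M" "U' 0 = 0" "U (pi/2) = 0"
      and I: "integral {0..pi/2} (\<lambda>y. g (U y) * cos y) = \<mu> * (pi / 4)"
    then have "0 < integral {0..pi/2} (\<lambda>y. g (U y) * cos y)" by (intro pos[of U U' h]) auto
    then show "0 < \<mu>" by (simp add: I zero_less_mult_iff)
  qed
  then show ?thesis using M by blast
qed

text \<open>The sign result sees a trajectory only through u'' + u = f with f bounded, so it applies
  to -g and -H along solutions of the original equation.\<close>

lemma zeros_negative:
  assumes H: "\<And>t. (H has_real_derivative g t * t) (at t)" and "H 0 = 0"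
    and "filterlim \<xi> at_top sequentially" "0 < \<delta>" and "\<And>n. H (\<xi> n) < - \<delta>"
  shows "\<exists>M\<ge>N. \<forall>\<mu>. endpoint M \<mu> = 0 \<longrightarrow> \<mu> < 0"
proof -
  obtain M where M: "N \<le> M" and pos: "\<And>u u' f. (\<forall>y\<in>{0..pi/2}. (u has_real_derivative u' y) (at y)) \<Longrightarrow>
    (\<forall>y\<in>{0..pi/2}. (u' has_real_derivative f y - u y) (at y)) \<Longrightarrow>
    (\<forall>y\<in>{0..pi/2}. \<bar>f y\<bar> \<le> 3 * G + E) \<Longrightarrow> u 0 = M \<Longrightarrow> u' 0 = 0 \<Longrightarrow> u (pi/2) = 0 \<Longrightarrow>
    0 < integral {0..pi/2} (\<lambda>y. - g (u y) * cos y)"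
  proof -
    have "continuous_on UNIV (\<lambda>t. - g t)" by (intro continuous_intros gc)
    moreover have "((\<lambda>t. - H t) has_real_derivative - g t * t) (at t)" for t
      using DERIV_minus[OF H] by simp
    moreover have "\<delta> < - H (\<xi> n)" for n using assms(5)[of n] by linarith
    ultimately show ?thesis
      using sign_at_arbitrarily_large_amplitude[of "\<lambda>t. - g t" G "\<lambda>t. - H t" \<xi> \<delta> "3 * G + E" N]
        assms(2-4) G_nonneg E_nonneg gG that by auto
  qed
  have "\<mu> < 0" if "endpoint M \<mu> = 0" for \<mu>
  proof (rule even_solution[OF that])
    fix U U' h
    assume "\<And>y. (U has_real_derivative U' y) (at y)" "\<And>y. (U' has_real_derivative h y - U y) (at y)"
      "\<And>y. \<bar>y\<bar> \<le> pi/2 \<Longrightarrow> \<bar>h y\<bar> \<le> 3 * G + E" "U 0 = M" "U' 0 = 0" "U (pi/2) = 0"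
      and I: "integral {0..pi/2} (\<lambda>y. g (U y) * cos y) = \<mu> * (pi / 4)"
    then have "0 < integral {0..pi/2} (\<lambda>y. - g (U y) * cos y)" by (intro pos[of U U' h]) auto
    then have "0 < - (\<mu> * (pi / 4))" by (simp add: I)
    then show "\<mu> < 0" by (simp add: mult_less_0_iff)
  qed
  then show ?thesis using M by blast
qed

text \<open>Shifting the even solution by pi/2 makes both boundary values equal to U(pi/2) = 0. For
  the last conclusion, u \<ge> M sin x - B with B = 3 G + E; pairing with sin loses at most B pi,
  that is 2 B after division by pi/2. So a large amplitude forces a large first harmonic.\<close>

lemma solution_of_zero:
  assumes e: "\<And>x. x \<in> {0<..<pi} \<Longrightarrow> e x = \<epsilon> (x - pi/2)" and z: "endpoint M \<mu> = 0"
  obtains u \<xi> where "is_solution g e \<mu> u" "has_first_harmonic u \<xi>" "u (pi/2) = M"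
    "M - 2 * (3 * G + E) \<le> \<xi>"
proof (rule even_solution[OF z])
  fix U U' h
  assume U: "\<And>y. (U has_real_derivative U' y) (at y)" "\<And>y. (U' has_real_derivative h y - U y) (at y)"
    "continuous_on UNIV h" "\<And>y. \<bar>y\<bar> \<le> pi/2 \<Longrightarrow> h y = (\<mu> * cos y + \<epsilon> y) - g (U y)"
    "\<And>y. \<bar>y\<bar> \<le> pi/2 \<Longrightarrow> \<bar>h y\<bar> \<le> 3 * G + E" "\<And>y. U (- y) = U y" "U 0 = M" "U' 0 = 0" "U (pi/2) = 0"
  define B where "B = 3 * G + E"
  have B0: "0 \<le> B" using G_nonneg E_nonneg by (simp add: B_def)
  define u where "u = restrict (\<lambda>x. U (x - pi/2)) {0..pi}"
  define u1 where "u1 x = U' (x - pi/2)" for x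
  define u2 where "u2 x = h (x - pi/2) - U (x - pi/2)" for x
  have uU: "u x = U (x - pi/2)" if "x \<in> {0..pi}" for x using that by (simp add: u_def)
  have Uc: "continuous_on A (\<lambda>x. U (x - pi/2))" for A
  proof -
    have "continuous_on UNIV U" by (rule DERIV_continuous_on[of _ _ U']) (simp add: U)
    then show ?thesis by (rule continuous_on_compose2) (auto intro!: continuous_intros)
  qed
  have d1: "(u has_real_derivative u1 x) (at x)" if x: "x \<in> {0<..<pi}" for x
  proof (rule has_field_derivative_transform_within_open[OF _ _ x])
    show "((\<lambda>x. U (x - pi/2)) has_real_derivative u1 x) (at x)"
      unfolding u1_def by (rule DERIV_cong[OF DERIV_chain2[OF U(1)]]) (auto intro!: derivative_eq_intros)
  qed (auto simp: uU)
  have d2: "(u1 has_real_derivative u2 x) (at x)" for x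
    unfolding u1_def u2_def
    by (rule DERIV_cong[OF DERIV_chain2[OF U(2)]]) (auto intro!: derivative_eq_intros)
  have u2c: "continuous_on {0<..<pi} u2"
    unfolding u2_def
    by (intro continuous_on_diff Uc continuous_on_compose2[OF U(3)]) (auto intro!: continuous_intros)
  have C: "Ck_on 2 u {0<..<pi}" "\<And>x. x \<in> {0<..<pi} \<Longrightarrow> deriv (deriv u) x = u2 x"
    using Ck_on_2I[of "{0<..<pi}" u u1 u2] d1 d2 u2c by simp_all
  have uc: "continuous_on {0..pi} u"
    by (rule continuous_on_cong[THEN iffD1, OF refl _ Uc]) (simp add: uU)
  have sol: "is_solution g e \<mu> u"
    unfolding is_solution_def
  proof (intro conjI ballI uc C(1))
    show "u \<in> extensional {0..pi}" by (simp add: u_def)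
    show "u 0 = 0" "u pi = 0" using U(6)[of "pi/2"] U(9) by (simp_all add: uU)
    fix x assume x: "x \<in> {0<..<pi}"
    have "\<bar>x - pi/2\<bar> \<le> pi/2" using x by (auto simp: abs_if)
    then have "h (x - pi/2) = \<mu> * cos (x - pi/2) + \<epsilon> (x - pi/2) - g (U (x - pi/2))" by (rule U(4))
    moreover have "cos (x - pi/2) = sin x" by (simp add: cos_diff)
    ultimately show "deriv (deriv u) x + u x + g (u x) = \<mu> * sin x + e x"
      using C(2)[OF x] x e[OF x] uU[of x] by (simp add: u2_def)
  qed
  have near: "M * cos y - B \<le> U y" if y: "\<bar>y\<bar> \<le> pi/2" for y
  proof -
    have "\<bar>(\<lambda>y. U y - M * cos y) \<bar>y\<bar>\<bar> \<le> B * (1 - cos \<bar>y\<bar>)"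
    proof (rule duhamel_bounds(2)[where V = "\<lambda>y. U' y + M * sin y" and f = h])
      show "((\<lambda>y. U y - M * cos y) has_real_derivative U' y + M * sin y) (at y)" for y
        by (auto intro!: derivative_eq_intros U)
      show "((\<lambda>y. U' y + M * sin y) has_real_derivative h y - (U y - M * cos y)) (at y)" for y
        by (auto intro!: derivative_eq_intros U)
    qed (use U y in \<open>auto simp: B_def\<close>)
    also have "\<dots> \<le> B * 1"
      using B0 y cos_ge_zero[of "\<bar>y\<bar>"] by (intro mult_left_mono) auto
    moreover have "U \<bar>y\<bar> = U y" using U(6) by (simp add: abs_if)
    ultimately show ?thesis by (simp add: abs_if split: if_splits)
  qed
  define \<xi> where "\<xi> = integral {0..pi} (\<lambda>x. u x * sin x) / (pi / 2)"
  have usc: "continuous_on {0..pi} (\<lambda>x. u x * sin x)" by (intro continuous_intros uc)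
  have I: "((\<lambda>x. u x * sin x) has_integral \<xi> * (pi / 2)) {0..pi}"
    using integrable_integral[OF integrable_continuous_real[OF usc]] by (simp add: \<xi>_def)
  have J: "((\<lambda>x. M * (sin x)\<^sup>2 - B) has_integral M * (pi / 2) - B * pi) {0..pi}"
    using has_integral_diff[OF has_integral_mult_right[OF has_integral_sin_squared, of M]
        has_integral_const_real[of B 0 pi]] by (simp add: mult.commute)
  have "M * (pi / 2) - B * pi \<le> \<xi> * (pi / 2)"
  proof (rule has_integral_le[OF J I])
    fix x assume x: "x \<in> {0..pi}"
    have "\<bar>x - pi/2\<bar> \<le> pi/2" using x by (auto simp: abs_if)
    from near[OF this] have "M * sin x - B \<le> u x" using uU[OF x] by (simp add: cos_diff)
    moreover have s: "0 \<le> sin x" using x by (auto intro: sin_ge_zero)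
    ultimately have "(M * sin x - B) * sin x \<le> u x * sin x" by (rule mult_right_mono)
    moreover have "B * sin x \<le> B * 1" using B0 by (intro mult_left_mono) auto
    ultimately show "M * (sin x)\<^sup>2 - B \<le> u x * sin x" by (simp add: algebra_simps power2_eq_square)
  qed
  then have "(M - 2 * B) * (pi / 2) \<le> \<xi> * (pi / 2)" by (simp add: algebra_simps)
  then have "M - 2 * B \<le> \<xi>" by (rule mult_right_le_imp_le) simp
  then show thesis
    by (intro that[OF sol has_first_harmonicI[OF I]]) (simp_all add: uU U(7) B_def)
qed

end

section \<open>The solution curve\<close>

lemma even_integral_halves:
  fixes k :: "real \<Rightarrow> real"
  assumes kc: "continuous_on UNIV k" and k: "\<And>t. k (- t) = k t" and b: "0 \<le> b"
  shows "integral {0..2 * b} (\<lambda>x. k (x - b)) = 2 * integral {0..b} k"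
proof -
  obtain A where A: "\<And>x. (A has_vector_derivative k x) (at x)"
    using einterval_antiderivative[of "-\<infinity>" "\<infinity>" k] kc by (auto simp: continuous_on_eq_continuous_at)
  then have A: "\<And>x. (A has_real_derivative k x) (at x)"
    by (simp add: has_real_derivative_iff_has_vector_derivative)
  have "A (- b) + A b = A (- 0) + A 0"
    by (rule DERIV_isconst_all)
      (auto intro!: derivative_eq_intros DERIV_chain2[OF A] A simp: k)
  moreover have "(k has_integral A b - A 0) {0..b}"
    using b A by (intro fundamental_theorem_of_calculus)
      (auto simp: has_real_derivative_iff_has_vector_derivative intro: has_vector_derivative_at_within)
  moreover have "((\<lambda>x. k (x - b)) has_integral A (2 * b - b) - A (0 - b)) {0..2 * b}"
  proof (rule fundamental_theorem_of_calculus)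
    fix x
    have "((\<lambda>x. A (x - b)) has_real_derivative k (x - b)) (at x)"
      by (rule DERIV_cong[OF DERIV_chain2[OF A]]) (auto intro!: derivative_eq_intros)
    then show "((\<lambda>x. A (x - b)) has_vector_derivative k (x - b)) (at x within {0..2 * b})"
      by (simp add: has_real_derivative_iff_has_vector_derivative has_vector_derivative_at_within)
  qed (use b in auto)
  ultimately show ?thesis by (simp add: integral_unique)
qed

lemma changes_sign_infinitely_oftenI:
  assumes pos: "\<And>N. \<exists>t\<ge>N. 0 < f t" and neg: "\<And>N. \<exists>t\<ge>N. f t < 0"
  shows "changes_sign_infinitely_often_at_top f"
proof -
  \<comment> \<open>The invariant f (t n) \<noteq> 0 tells which sign to look for next, and steps of
    length at least 1 send the sequence to infinity.\<close>
  have "\<exists>t. \<forall>n. f (t n) \<noteq> 0 \<and> (t n + 1 \<le> t (Suc n) \<and> f (t n) * f (t (Suc n)) < 0)"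
  proof (rule dependent_nat_choice)
    show "\<exists>x. f x \<noteq> 0" using pos[of 0] by (metis less_irrefl)
    fix x :: real and n :: nat assume "f x \<noteq> 0"
    then consider "0 < f x" | "f x < 0" by linarith
    then show "\<exists>y. f y \<noteq> 0 \<and> (x + 1 \<le> y \<and> f x * f y < 0)"
    proof cases
      case 1
      with neg[of "x + 1"] show ?thesis by (metis less_irrefl mult_pos_neg)
    next
      case 2
      with pos[of "x + 1"] show ?thesis by (metis less_irrefl mult_neg_pos)
    qed
  qed
  then obtain t where t: "\<And>n. t n + 1 \<le> t (Suc n)" "\<And>n. f (t n) * f (t (Suc n)) < 0" by blast
  have "t 0 + real n \<le> t n" for n
  proof (induction n)
    case (Suc n)
    then show ?case using t(1)[of n] by simp
  qed simp
  then have t0: "t 0 + real n \<le> t n" for n .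
  have "filterlim t at_top sequentially"
    unfolding filterlim_at_top eventually_sequentially
  proof (intro allI)
    fix Z
    obtain n0 where n0: "Z - t 0 \<le> real n0" using real_arch_simple by blast
    have "Z \<le> t n" if "n0 \<le> n" for n
    proof -
      have "real n0 \<le> real n" using that by simp
      then show ?thesis using n0 t0[of n] by linarith
    qed
    then show "\<exists>n0. \<forall>n\<ge>n0. Z \<le> t n" by blast
  qed
  moreover have "strict_mono t"
    unfolding strict_mono_Suc_iff
  proof
    show "t n < t (Suc n)" for n using t(1)[of n] by linarith
  qed
  ultimately show ?thesis
    unfolding changes_sign_infinitely_often_at_top_def using t(2) by blast
qed

text \<open>The class constrains e only inside the interval, while shooting uses a continuous
  forcing up to the ends. Uniform continuity, hence an extension, comes from the Hoelder estimate if
  k = 0 and from the bounded first derivative if k > 0.\<close>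

lemma holder_on_continuous_extension:
  assumes "holder_on \<alpha> e {0<..<pi}"
  obtains f where "continuous_on {0..pi} f" "\<And>x. x \<in> {0<..<pi} \<Longrightarrow> f x = e x"
proof -
  obtain k \<beta> C where \<beta>: "0 < \<beta>" and Ck: "Ck_on k e {0<..<pi}"
    and bd: "\<And>j. j \<le> k \<Longrightarrow> bounded ((deriv ^^ j) e ` {0<..<pi})"
    and hoe: "\<And>x y. x \<in> {0<..<pi} \<Longrightarrow> y \<in> {0<..<pi} \<Longrightarrow>
      \<bar>(deriv ^^ k) e x - (deriv ^^ k) e y\<bar> \<le> C * \<bar>x - y\<bar> powr \<beta>"
    using assms unfolding holder_on_def by blast
  have "uniformly_continuous_on {0<..<pi} e"
  proof (cases k)
    case 0
    show ?thesis
      unfolding uniformly_continuous_on_def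
    proof (intro allI impI)
      fix \<delta> :: real assume \<delta>: "0 < \<delta>"
      \<comment> \<open>Solves s powr \<beta> = \<delta> / (|C| + 1); the summand 1 covers C = 0 and
        makes the final inequality strict.\<close>
      define s where "s = (\<delta> / (\<bar>C\<bar> + 1)) powr (1 / \<beta>)"
      have s: "0 < s" using \<delta> by (simp add: s_def)
      have "dist (e y) (e x) < \<delta>" if xy: "x \<in> {0<..<pi}" "y \<in> {0<..<pi}" "dist y x < s" for x y
      proof -
        have "\<bar>y - x\<bar> powr \<beta> \<le> s powr \<beta>" using xy(3) \<beta> by (intro powr_mono2) (auto simp: dist_real_def)
        also have "\<dots> = \<delta> / (\<bar>C\<bar> + 1)" using \<beta> \<delta> by (simp add: s_def powr_powr)
        finally have *: "\<bar>y - x\<bar> powr \<beta> \<le> \<delta> / (\<bar>C\<bar> + 1)" .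
        have "dist (e y) (e x) \<le> C * \<bar>y - x\<bar> powr \<beta>"
          using hoe[OF xy(2,1)] 0 by (simp add: dist_real_def)
        also have "\<dots> \<le> \<bar>C\<bar> * \<bar>y - x\<bar> powr \<beta>" by (intro mult_right_mono) auto
        also have "\<dots> \<le> \<bar>C\<bar> * (\<delta> / (\<bar>C\<bar> + 1))" using * by (intro mult_left_mono) auto
        also have "\<dots> < \<delta>" using \<delta> by (simp add: field_simps)
        finally show ?thesis .
      qed
      then show "\<exists>s>0. \<forall>x\<in>{0<..<pi}. \<forall>y\<in>{0<..<pi}. dist y x < s \<longrightarrow> dist (e y) (e x) < \<delta>"
        using s by blast
    qed
  next
    case (Suc m)
    obtain K where K: "\<And>x. x \<in> {0<..<pi} \<Longrightarrow> \<bar>deriv e x\<bar> \<le> K"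
    proof -
      have "bounded (deriv e ` {0<..<pi})" using bd[of 1] Suc by simp
      then show ?thesis using that unfolding bounded_iff by (metis imageI real_norm_def)
    qed
    have d: "(e has_real_derivative deriv e x) (at x)" if "x \<in> {0<..<pi}" for x
    proof -
      have "(deriv ^^ 0) e field_differentiable at x"
        using Ck that Suc unfolding Ck_on_def by blast
      then show ?thesis by (simp add: field_differentiable_derivI)
    qed
    have K0: "0 \<le> K" using K[of "pi/2"] by (simp add: order_trans[OF abs_ge_zero])
    have "K-lipschitz_on {0<..<pi} e"
    proof (rule lipschitz_onI[OF _ K0])
      fix x y assume xy: "x \<in> {0<..<pi}" "y \<in> {0<..<pi}"
      have "norm (e x - e y) \<le> K * norm (x - y)"
        by (rule field_differentiable_bound[of "{0<..<pi}" e "deriv e"])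
          (use xy d K in \<open>auto intro: has_field_derivative_at_within\<close>)
      then show "dist (e x) (e y) \<le> K * dist x y" by (simp add: dist_real_def)
    qed
    then show ?thesis by (rule lipschitz_on_uniformly_continuous)
  qed
  from uniformly_continuous_on_extension_on_closure[OF this]
  obtain f where "uniformly_continuous_on (closure {0<..<pi}) f" "\<And>x. x \<in> {0<..<pi} \<Longrightarrow> e x = f x"
    by metis
  then show thesis using that[of f] by (simp add: uniformly_continuous_imp_continuous)
qed

text \<open>Uniformity in z is used at one fixed large u: as z varies, u z runs through the whole
  line, so |g| \<le> u everywhere.\<close>

lemma bounded_of_uniform_sublinear:
  fixes g :: "real \<Rightarrow> real"
  assumes "uniform_limit UNIV (\<lambda>u z. g (u * z) / u) (\<lambda>z. 0) at_infinity"
  obtains G where "\<And>t. \<bar>g t\<bar> \<le> G"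
proof -
  have "\<forall>\<^sub>F u in at_infinity. \<forall>z\<in>UNIV. dist (g (u * z) / u) 0 < 1"
    by (rule uniform_limitD[OF assms]) simp
  then obtain b where b: "\<And>u z. b \<le> norm u \<Longrightarrow> dist (g (u * z) / u) 0 < 1"
    unfolding eventually_at_infinity by blast
  define u where "u = max b 1"
  have u: "0 < u" "b \<le> norm u" by (auto simp: u_def)
  have "\<bar>g t\<bar> \<le> u" for t
    using b[OF u(2), of "t / u"] u(1) by (simp add: field_simps)
  then show thesis by (rule that)
qed

section \<open>Local Lipschitz bounds, and differentiation of the primitive H\<close>

lemma C1_imp_lipschitz_on_bounded:
  fixes g g' :: "real \<Rightarrow> real"
  assumes g: "\<And>t. (g has_real_derivative g' t) (at t)" and g': "continuous_on UNIV g'"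
  shows "\<exists>L>0. \<forall>s t. \<bar>s\<bar> \<le> R \<longrightarrow> \<bar>t\<bar> \<le> R \<longrightarrow> \<bar>g s - g t\<bar> \<le> L * \<bar>s - t\<bar>"
proof -
  obtain K where K: "\<And>t. t \<in> {-R..R} \<Longrightarrow> \<bar>g' t\<bar> \<le> K"
    using compact_imp_bounded[OF compact_continuous_image[OF continuous_on_subset[OF g' subset_UNIV] compact_Icc]]
    unfolding bounded_iff by (metis imageI real_norm_def)
  have "\<bar>g s - g t\<bar> \<le> max K 1 * \<bar>s - t\<bar>" if "\<bar>s\<bar> \<le> R" "\<bar>t\<bar> \<le> R" for s t
  proof -
    have "norm (g s - g t) \<le> max K 1 * norm (s - t)"
    proof (rule field_differentiable_bound[of "{-R..R}" g g'])
      show "norm (g' z) \<le> max K 1" if "z \<in> {-R..R}" for z using K[OF that] by simp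
    qed (use that g in \<open>auto intro: has_field_derivative_at_within\<close>)
    then show ?thesis by simp
  qed
  then show ?thesis by (intro exI[of _ "max K 1"]) auto
qed

lemma primitive_of_interval_integral:
  fixes k H :: "real \<Rightarrow> real"
  assumes k: "continuous_on UNIV k" and H: "\<And>u. H u = (LBINT t=0..u. k t)"
  shows "(H has_real_derivative k u) (at u)" and "H 0 = 0"
proof -
  obtain A where A: "\<And>x. (A has_vector_derivative k x) (at x)"
    using einterval_antiderivative[of "-\<infinity>" "\<infinity>" k] k by (auto simp: continuous_on_eq_continuous_at)
  have HA: "H = (\<lambda>u. A u - A 0)"
  proof
    fix u
    have "(LBINT t=ereal 0..ereal u. k t) = A u - A 0"
      by (rule interval_integral_FTC_finite)
        (use A k in \<open>auto intro: continuous_on_subset has_vector_derivative_at_within\<close>)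
    then show "H u = A u - A 0" by (simp add: H zero_ereal_def)
  qed
  have "((\<lambda>u. A u - A 0) has_real_derivative k u) (at u)"
    using A by (auto simp: has_real_derivative_iff_has_vector_derivative intro!: derivative_eq_intros)
  then show "(H has_real_derivative k u) (at u)" by (simp add: HA)
  show "H 0 = 0" by (simp add: HA)
qed

theorem theorem4p3:
  fixes e g H :: "real \<Rightarrow> real"
    and \<alpha> \<gamma> c \<epsilon> :: real
    and \<xi> \<eta> :: "nat \<Rightarrow> real"
  assumes "0 < \<alpha>" and "holder_on \<alpha> e {0<..<pi}"
    and "\<forall>x\<in>{0<..<pi}. e (pi - x) = e x"
    and "((\<lambda>x. e x * sin x) has_integral 0) {0..pi}"
    and "Ck_on 2 g UNIV"
    and "\<forall>u. deriv g u < 3"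
    and "0 < \<gamma>" and "\<gamma> < 3" and "0 \<le> c" and "\<forall>u. \<bar>g u\<bar> < \<gamma> * \<bar>u\<bar> + c"
    and "uniform_limit UNIV (\<lambda>u z. g (u * z) / u) (\<lambda>z. 0) at_infinity"
    and "\<forall>a b. finite {r \<in> {a..b}. g r = 0}"
    and "\<forall>r. g r = 0 \<longrightarrow> changes_sign_at g r"
    and "\<forall>u. H u = (LBINT t=0..u. g t * t)"
    and "filterlim \<xi> at_top sequentially" and "filterlim \<eta> at_top sequentially"
    and "0 < \<epsilon>" and "\<forall>n. H (\<xi> n) > \<epsilon>" and "\<forall>n. H (\<eta> n) < - \<epsilon>"
  shows "changes_sign_infinitely_often_at_top (mu1 g e) \<and> infinite {u. is_solution g e 0 u}"
proof -
  obtain G where G: "\<And>t. \<bar>g t\<bar> \<le> G" using bounded_of_uniform_sublinear[OF assms(11)] by blast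
  have g: "(g has_real_derivative deriv g t) (at t)" for t
  proof -
    have "(deriv ^^ 0) g field_differentiable at t"
      using assms(5) unfolding Ck_on_def by (metis UNIV_I pos2)
    then show ?thesis by (simp add: field_differentiable_derivI)
  qed
  have g'c: "continuous_on UNIV (deriv g)"
  proof -
    have "continuous_on UNIV ((deriv ^^ 1) g)"
      using assms(5) unfolding Ck_on_def by (metis one_le_numeral)
    then show ?thesis by simp
  qed
  have gc: "continuous_on UNIV g" by (rule DERIV_continuous_on[of _ _ "deriv g"]) (simp add: g)
  have g3: "deriv g t < 3" for t using assms(6) by blast
  have gtc: "continuous_on UNIV (\<lambda>t. g t * t)" by (intro continuous_intros gc)
  note H = primitive_of_interval_integral[OF gtc assms(14)[rule_format]]
  obtain f where f: "continuous_on {0..pi} f" "\<And>x. x \<in> {0<..<pi} \<Longrightarrow> f x = e x"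
    using holder_on_continuous_extension[OF assms(2)] by blast
  \<comment> \<open>The right half reflected about the midpoint and held constant beyond the ends;
    it agrees with the shifted e because e is even about pi/2.\<close>
  define \<epsilon>' where "\<epsilon>' t = f (pi/2 + min \<bar>t\<bar> (pi/2))" for t
  have \<epsilon>'c: "continuous_on UNIV \<epsilon>'"
    unfolding \<epsilon>'_def by (intro continuous_on_compose2[OF f(1)] continuous_intros) auto
  have \<epsilon>'e: "e x = \<epsilon>' (x - pi/2)" if x: "x \<in> {0<..<pi}" for x
  proof (cases "pi/2 \<le> x")
    case True
    then show ?thesis using x f(2)[of x] by (simp add: \<epsilon>'_def)
  next
    case False
    then have "\<epsilon>' (x - pi/2) = f (pi - x)" using x by (simp add: \<epsilon>'_def)
    then show ?thesis using x f(2)[of "pi - x"] assms(3) by simp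
  qed
  obtain E where E: "\<And>x. x \<in> {0..pi} \<Longrightarrow> \<bar>f x\<bar> \<le> E"
    using compact_imp_bounded[OF compact_continuous_image[OF f(1) compact_Icc]]
    unfolding bounded_iff by (metis imageI real_norm_def)
  have orth: "integral {0..pi/2} (\<lambda>t. cos t * \<epsilon>' t) = 0"
  proof -
    \<comment> \<open>The extension may differ from e at 0 and pi, a finite set that does not affect
      the integral.\<close>
    have "((\<lambda>x. cos (x - pi/2) * \<epsilon>' (x - pi/2)) has_integral 0) {0..pi}"
      by (rule has_integral_spike_finite[OF _ _ assms(4), of "{0, pi}"])
        (auto simp: \<epsilon>'e cos_diff less_le)
    then have "integral {0..2 * (pi/2)} (\<lambda>x. cos (x - pi/2) * \<epsilon>' (x - pi/2)) = 0"
      by (simp add: integral_unique)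
    moreover have "integral {0..2 * (pi/2)} (\<lambda>x. cos (x - pi/2) * \<epsilon>' (x - pi/2))
        = 2 * integral {0..pi/2} (\<lambda>t. cos t * \<epsilon>' t)"
    proof (rule even_integral_halves)
      show "continuous_on UNIV (\<lambda>t. cos t * \<epsilon>' t)" by (intro continuous_intros \<epsilon>'c)
    qed (simp_all add: \<epsilon>'_def)
    ultimately show ?thesis by simp
  qed
  interpret centered_problem g \<epsilon>' G E
  proof
    show "\<bar>\<epsilon>' t\<bar> \<le> E" for t unfolding \<epsilon>'_def by (rule E) auto
  qed (use gc G C1_imp_lipschitz_on_bounded[OF g g'c] \<epsilon>'c orth in \<open>auto simp: \<epsilon>'_def\<close>)
  have pos: "\<exists>M\<ge>N. \<forall>\<mu>. endpoint M \<mu> = 0 \<longrightarrow> 0 < \<mu>" for N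
    using zeros_positive[OF H assms(15,17)] assms(18) by blast
  have neg: "\<exists>M\<ge>N. \<forall>\<mu>. endpoint M \<mu> = 0 \<longrightarrow> \<mu> < 0" for N
    using zeros_negative[OF H assms(16,17)] assms(19) by blast
  \<comment> \<open>A zero \<mu> at amplitude M is the value of the curve at some \<xi> \<ge> M - 2
    (3 G + E). As \<open>pos\<close> and \<open>neg\<close> fix the sign of every zero, it does not
    matter which one is taken.\<close>
  have curve: "\<exists>\<xi>\<ge>N. \<exists>\<mu>. endpoint M \<mu> = 0 \<and> mu1 g e \<xi> = \<mu>" if "N + 2 * (3 * G + E) \<le> M" for N M
  proof -
    obtain \<mu> where \<mu>: "endpoint M \<mu> = 0" using endpoint_zero_exists by blast
    obtain u \<xi> where "is_solution g e \<mu> u" "has_first_harmonic u \<xi>" "M - 2 * (3 * G + E) \<le> \<xi>"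
      using solution_of_zero[OF \<epsilon>'e \<mu>] by blast
    then have "mu1 g e \<xi> = \<mu>" "N \<le> \<xi>" using mu1_eq[OF g g3 G] that by auto
    then show ?thesis using \<mu> by blast
  qed
  have "changes_sign_infinitely_often_at_top (mu1 g e)"
  proof (rule changes_sign_infinitely_oftenI)
    fix N
    show "\<exists>\<xi>\<ge>N. 0 < mu1 g e \<xi>" using pos[of "N + 2 * (3 * G + E)"] curve by metis
    show "\<exists>\<xi>\<ge>N. mu1 g e \<xi> < 0" using neg[of "N + 2 * (3 * G + E)"] curve by metis
  qed
  moreover have "infinite {u. is_solution g e 0 u}"
  proof
    assume "finite {u. is_solution g e 0 u}"
    \<comment> \<open>Finitely many solutions would have midpoint values bounded by some K; but at
      \<mu> = 0 the endpoint value takes both signs at amplitudes from K + 1 on, and a zero between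
      them is a solution with a larger midpoint value.\<close>
    then have "finite ((\<lambda>u. u (pi/2)) ` {u. is_solution g e 0 u})" by (rule finite_imageI)
    then obtain K where K: "\<And>u. is_solution g e 0 u \<Longrightarrow> u (pi/2) \<le> K"
      using bdd_above_finite unfolding bdd_above_def by blast
    obtain M1 where M1: "K + 1 \<le> M1" "endpoint M1 0 < 0"
      using pos[of "K + 1"] endpoint_neg_if_zeros_pos by blast
    obtain M2 where M2: "K + 1 \<le> M2" "0 < endpoint M2 0"
      using neg[of "K + 1"] endpoint_pos_if_zeros_neg by blast
    have "\<exists>M. min M1 M2 \<le> M \<and> endpoint M 0 = 0"
    proof (cases "M1 \<le> M2")
      case True
      then obtain M where "M1 \<le> M" "endpoint M 0 = 0"
        using IVT'[OF less_imp_le[OF M1(2)] less_imp_le[OF M2(2)] _ endpoint_continuous(1)] by blast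
      then show ?thesis by (intro exI[of _ M]) simp
    next
      case False
      then have "M2 \<le> M1" by simp
      then obtain M where "M2 \<le> M" "endpoint M 0 = 0"
        using IVT2'[OF less_imp_le[OF M1(2)] less_imp_le[OF M2(2)] _ endpoint_continuous(1)] by blast
      then show ?thesis by (intro exI[of _ M]) simp
    qed
    then obtain M where M: "min M1 M2 \<le> M" "endpoint M 0 = 0" by blast
    obtain u where "is_solution g e 0 u" "u (pi/2) = M"
      using solution_of_zero[OF \<epsilon>'e M(2)] by blast
    then show False using K[of u] M(1) M1(1) M2(1) by auto
  qed
  ultimately show ?thesis by blast
qed

end
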